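(* Let $k,n\in\mathbb{N}$ with $3\leq k\leq n-1$. Let $\{D_I\}_{I\in\binom{[n]}{k}}$ be an l-treelike family of real numbers and let $U$ be the set of weighted trees with leaf set $[n]$ realizing the family. (i) If every element of $U$ is a pseudostar of kind $(n,k)$ (for instance if $k\leq n/2$), then $D_{tot}(\mathcal{P})=D_{tot}(\mathcal{P}')$ for all $\mathcal{P},\mathcal{P}'\in U$; in particular $\inf_{\mathcal{P}\in U} D_{tot}(\mathcal{P}) = \sup_{\mathcal{P}\in U} D_{tot}(\mathcal{P})$. (ii) If $U$ contains a weighted tree which is not a pseudostar of kind $(n,k)$, then $\inf_{\mathcal{T}\in U} D_{tot}(\mathcal{T})=-\infty$ and $\sup_{\mathcal{T}\in U} D_{tot}(\mathcal{T})=+\infty$.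
   Context: A weighted tree $\mathcal{T}=(T,w)$ is a finite tree with $w:E(T)\to\mathbb{R}$ (weights may be any real numbers). $D_I(\mathcal{T})$ is the total weight of the minimal subtree containing $I$; $D_{tot}(\mathcal{T})$ is the sum of the weights of all edges. A weighted tree with leaf set $[n]$ realizes $\{D_I\}_I$ if $D_I(\mathcal{T})=D_I$ for all $I\in\binom{[n]}{k}$. The family is l-treelike if there is a weighted tree and a subset $S$ of its leaves, identified with $[n]$, with $D_I(\mathcal{T})=D_I$ for all $k$-subsets $I\subseteq S$. A tree $P$ is a pseudostar of kind $(n,k)$ if $\#L(P)=n$ and every edge divides $L(P)$ into two sets at least one of which has cardinality $\geq k$. *)

theory Defs
  imports Complex_Main "HOL-Library.Extended_Real" "HOL-Library.Ramsey"
begin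

text \<open>
  A simple undirected graph is a set of vertices with a set of two-element sets of vertices.
  The notion \<open>tree\<close> of the AFP entry Graph_Theory concerns directed cycles only, and
  hence does not describe undirected trees.
\<close>

record 'v ugraph =
  verts :: "'v set"
  edges :: "'v set set"

definition adj :: "'v set set \<Rightarrow> ('v \<times> 'v) set" where
  "adj E = {(u, v). {u, v} \<in> E}"

definition simple_graph :: "'v ugraph \<Rightarrow> bool" where
  "simple_graph G \<longleftrightarrow> finite (verts G) \<and> edges G \<subseteq> [verts G]\<^bsup>2\<^esup>"

definition connected_graph :: "'v ugraph \<Rightarrow> bool" where
  "connected_graph G \<longleftrightarrow>
     verts G \<noteq> {} \<and> (\<forall>u\<in>verts G. \<forall>v\<in>verts G. (u, v) \<in> (adj (edges G))\<^sup>*)"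

definition graph_cycle :: "'v ugraph \<Rightarrow> 'v list \<Rightarrow> bool" where
  "graph_cycle G c \<longleftrightarrow> 3 \<le> length c \<and> distinct c \<and>
     (\<forall>i < length c. {c ! i, c ! (Suc i mod length c)} \<in> edges G)"

definition is_tree :: "'v ugraph \<Rightarrow> bool" where
  "is_tree G \<longleftrightarrow> simple_graph G \<and> connected_graph G \<and> (\<nexists>c. graph_cycle G c)"

definition leaves :: "'v ugraph \<Rightarrow> 'v set" where
  "leaves G = {v \<in> verts G. card {e \<in> edges G. v \<in> e} = 1}"

definition subgraph_of :: "'v ugraph \<Rightarrow> 'v ugraph \<Rightarrow> bool" where
  "subgraph_of H G \<longleftrightarrow> verts H \<subseteq> verts G \<and> edges H \<subseteq> edges G"

definition subtree_of :: "'v ugraph \<Rightarrow> 'v ugraph \<Rightarrow> bool" where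
  "subtree_of H G \<longleftrightarrow> is_tree H \<and> subgraph_of H G"

definition minimal_subtree :: "'v ugraph \<Rightarrow> 'v set \<Rightarrow> 'v ugraph" where
  "minimal_subtree T I = (THE H. subtree_of H T \<and> I \<subseteq> verts H \<and>
     (\<forall>H'. subtree_of H' T \<and> I \<subseteq> verts H' \<longrightarrow> subgraph_of H H'))"

text \<open>
  A weighted tree is a pair of a tree and a weight function, of which only the values on the
  edges of the tree are ever used.
\<close>

type_synonym 'v weighted_tree = "'v ugraph \<times> ('v set \<Rightarrow> real)"

definition D_sub :: "'v weighted_tree \<Rightarrow> 'v set \<Rightarrow> real" where
  "D_sub = (\<lambda>(T, w) I. \<Sum>e\<in>edges (minimal_subtree T I). w e)"

definition D_tot :: "'v weighted_tree \<Rightarrow> real" where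
  "D_tot = (\<lambda>(T, w). \<Sum>e\<in>edges T. w e)"

text \<open>
  Every finite tree is isomorphic to one whose vertices are natural numbers, so \<open>nat\<close> serves as
  the universe of vertices. A family indexed by the \<open>k\<close>-subsets of \<open>{1..n}\<close> is a function
  \<open>D :: nat set \<Rightarrow> real\<close>, of which only the values on these subsets are used. The bijection \<open>f\<close>
  is the identification of \<open>{1..n}\<close> with the set \<open>S\<close> of leaves.
\<close>

definition l_treelike :: "nat \<Rightarrow> nat \<Rightarrow> (nat set \<Rightarrow> real) \<Rightarrow> bool" where
  "l_treelike n k D \<longleftrightarrow> (\<exists>(T :: nat ugraph) w S f. is_tree T \<and> S \<subseteq> leaves T \<and>
     bij_betw f {1..n} S \<and> (\<forall>I\<in>[{1..n}]\<^bsup>k\<^esup>. D_sub (T, w) (f ` I) = D I))"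

definition realizations :: "nat \<Rightarrow> nat \<Rightarrow> (nat set \<Rightarrow> real) \<Rightarrow> nat weighted_tree set" where
  "realizations n k D = {(T, w). is_tree T \<and> leaves T = {1..n} \<and>
     (\<forall>I\<in>[{1..n}]\<^bsup>k\<^esup>. D_sub (T, w) I = D I)}"

text \<open>
  For an edge \<open>{u, v}\<close> of \<open>T\<close>, the leaves of \<open>T\<close> lying in the connected component of \<open>u\<close>
  after deletion of that edge. The two sets \<open>leaf_side T u v\<close> and \<open>leaf_side T v u\<close> are those
  into which the edge divides the leaves.
\<close>

definition leaf_side :: "'v ugraph \<Rightarrow> 'v \<Rightarrow> 'v \<Rightarrow> 'v set" where
  "leaf_side T u v = {x \<in> leaves T. (u, x) \<in> (adj (edges T - {{u, v}}))\<^sup>*}"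

definition pseudostar :: "nat \<Rightarrow> nat \<Rightarrow> 'v ugraph \<Rightarrow> bool" where
  "pseudostar n k P \<longleftrightarrow> is_tree P \<and> card (leaves P) = n \<and>
     (\<forall>u v. {u, v} \<in> edges P \<longrightarrow> k \<le> card (leaf_side P u v) \<or> k \<le> card (leaf_side P v u))"

end

theory Submission
  imports Defs
begin

text \<open>
  The number \<open>D_I\<close> is the sum of the weights of the edges that separate \<open>I\<close>, so it depends only on
  the weighted splits of the leaves induced by the edges. The difference of two realizations is a
  weighted family of splits of the leaf set in which among any three members two are compatible,
  and which sums to \<open>0\<close> on all \<open>k\<close>-sets.

  For pseudostars with \<open>n < 2k\<close>, each split has a unique side with at most \<open>n - k\<close> elements.
  Passing to complements of \<open>k\<close>-sets, the weights \<open>u\<close> of these sides have constant sums over the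
  nonempty subsets of every \<open>(n - k)\<close>-set. Since no three sides cross pairwise, this forces \<open>u = 0\<close>,
  by induction on \<open>n - k\<close>. For \<open>n \<ge> 2k\<close>, this applies to each set of \<open>2k - 1\<close> leaves, so the
  difference vanishes on all sets of at most \<open>2k - 1\<close> leaves. If it vanishes on all sets with one
  or two leaves less than \<open>R\<close> and equals \<open>c\<close> on \<open>R\<close>, then the total weight of every split of \<open>R\<close>
  into a pair and its complement is \<open>-c\<close>. As the splits given by \<open>{a, p}\<close>, \<open>{a, q}\<close>, \<open>{a, r}\<close>
  are pairwise incompatible, one of them does not occur, and \<open>c = 0\<close>.
\<close>

section \<open>Weighted families of splits\<close>

definition crossing :: "'a set \<Rightarrow> 'a set \<Rightarrow> bool" where
  "crossing A B \<longleftrightarrow> A \<inter> B \<noteq> {} \<and> A - B \<noteq> {} \<and> B - A \<noteq> {}"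

text \<open>Apart from \<open>{p}\<close>, the nonempty subsets of \<open>insert p J\<close> come in
  pairs \<open>A\<close>, \<open>insert p A\<close>. This turns constant sums over
  \<open>(m + 1)\<close>-sets containing \<open>p\<close> into constant sums over
  \<open>m\<close>-sets avoiding \<open>p\<close>.\<close>

lemma sum_nonempty_subsets_insert:
  fixes u :: "'a set \<Rightarrow> real"
  assumes "finite J" "p \<notin> J"
  shows "(\<Sum>A\<in>Pow (insert p J) - {{}}. u A) = u {p} + (\<Sum>A\<in>Pow J - {{}}. u A + u (insert p A))"
proof -
  have eq: "Pow (insert p J) - {{}} = insert {p} ((Pow J - {{}}) \<union> insert p ` (Pow J - {{}}))"
    by (auto simp: Pow_insert)
  have inj: "inj_on (insert p) (Pow J - {{}})"
    using assms(2) by (auto simp: inj_on_def)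
  have "(\<Sum>A\<in>Pow (insert p J) - {{}}. u A)
      = u {p} + (\<Sum>A\<in>(Pow J - {{}}) \<union> insert p ` (Pow J - {{}}). u A)"
    unfolding eq using assms by (subst sum.insert) auto
  also have "(\<Sum>A\<in>(Pow J - {{}}) \<union> insert p ` (Pow J - {{}}). u A)
      = (\<Sum>A\<in>Pow J - {{}}. u A) + (\<Sum>A\<in>insert p ` (Pow J - {{}}). u A)"
    using assms by (intro sum.union_disjoint) auto
  also have "(\<Sum>A\<in>insert p ` (Pow J - {{}}). u A) = (\<Sum>A\<in>Pow J - {{}}. u (insert p A))"
    using inj by (simp add: sum.reindex)
  finally show ?thesis by (simp add: sum.distrib)
qed

lemma obtain_three_distinct:
  assumes "finite X" "3 \<le> card X"
  obtains a b c where "a \<in> X" "b \<in> X" "c \<in> X" "a \<noteq> b" "a \<noteq> c" "b \<noteq> c"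
proof -
  obtain Y where "Y \<subseteq> X" "card Y = 3" using assms by (meson obtain_subset_with_card_n)
  then show ?thesis using that by (auto simp: card_3_iff)
qed

text \<open>Two pairs cross exactly when they share one element, so the graph with an edge
  \<open>{i, j}\<close> whenever \<open>v i + v j\<close> is nonzero contains neither a triangle nor
  a star with three rays. On five or more vertices this leaves no room for a nonzero value of
  \<open>v\<close>.\<close>

lemma pair_weights_vanish:
  fixes v :: "'a \<Rightarrow> real"
  assumes X: "finite X" "5 \<le> card X"
    and edge: "\<And>i j. i \<in> X \<Longrightarrow> j \<in> X \<Longrightarrow> i \<noteq> j \<Longrightarrow> v i + v j \<noteq> 0 \<Longrightarrow> {i, j} \<in> F"
    and F: "\<And>A B C. A \<in> F \<Longrightarrow> B \<in> F \<Longrightarrow> C \<in> F \<Longrightarrow>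
              \<not> (crossing A B \<and> crossing A C \<and> crossing B C)"
    and i: "i \<in> X"
  shows "v i = 0"
proof (rule ccontr)
  assume vi: "v i \<noteq> 0"
  have triangle: False if "a \<in> X" "b \<in> X" "c \<in> X" "a \<noteq> b" "a \<noteq> c" "b \<noteq> c"
      "v a + v b \<noteq> 0" "v a + v c \<noteq> 0" "v b + v c \<noteq> 0" for a b c
    using F[OF edge[of a b] edge[of a c] edge[of b c]] that by (auto simp: crossing_def)
  have star: False if "z \<in> X" "a \<in> X" "b \<in> X" "c \<in> X" "a \<noteq> b" "a \<noteq> c" "b \<noteq> c"
      "z \<notin> {a, b, c}" "v z + v a \<noteq> 0" "v z + v b \<noteq> 0" "v z + v c \<noteq> 0" for z a b c
    using F[OF edge[of z a] edge[of z b] edge[of z c]] that by (auto simp: crossing_def)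
  have le2: "card N \<le> 2" if N: "N \<subseteq> X" "\<And>a b. a \<in> N \<Longrightarrow> b \<in> N \<Longrightarrow> v a + v b \<noteq> 0" for N
  proof (rule ccontr)
    assume "\<not> card N \<le> 2"
    moreover have "finite N" using finite_subset[OF N(1) X(1)] .
    ultimately obtain a b c where "a \<in> N" "b \<in> N" "c \<in> N" "a \<noteq> b" "a \<noteq> c" "b \<noteq> c"
      using obtain_three_distinct[of N] by (metis not_less_eq_eq numeral_2_eq_2 numeral_3_eq_3)
    then show False using triangle[of a b c] N by blast
  qed
  define P where "P = {x\<in>X. v x > 0}"
  define N where "N = {x\<in>X. v x < 0}"
  have PN: "card P \<le> 2" "card N \<le> 2"
    by (auto intro!: le2 simp: P_def N_def)
  \<comment> \<open>Three elements of the same sign would form a triangle, so at most four elements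
    have a nonzero value.\<close>
  have "\<exists>z\<in>X. v z = 0"
  proof (rule ccontr)
    assume "\<not> ?thesis"
    then have "X = P \<union> N" unfolding P_def N_def by (auto simp: neq_iff)
    then show False using card_Un_le[of P N] PN X by simp
  qed
  then obtain z where z: "z \<in> X" "v z = 0" by blast
  \<comment> \<open>\<open>M\<close> holds the neighbours of \<open>i\<close>, at most two since
    there is no star. Two elements outside \<open>insert i M\<close> remain, both of value
    \<open>- v i\<close>; together with \<open>i\<close> they are three neighbours of
    \<open>z\<close>.\<close>
  define M where "M = {x\<in>X - {i}. v i + v x \<noteq> 0}"
  have "card M \<le> 2"
  proof (rule ccontr)
    assume "\<not> card M \<le> 2"
    moreover have "finite M" using X by (simp add: M_def)
    ultimately obtain a b c where "a \<in> M" "b \<in> M" "c \<in> M" "a \<noteq> b" "a \<noteq> c" "b \<noteq> c"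
      using obtain_three_distinct[of M] by (metis not_less_eq_eq numeral_2_eq_2 numeral_3_eq_3)
    then show False using star[of i a b c] i by (auto simp: M_def)
  qed
  moreover have "card (insert i M) \<le> Suc (card M)" by (rule card_insert_le_m1) auto
  moreover have "card X - card (insert i M) \<le> card (X - insert i M)"
    by (rule diff_card_le_card_Diff) (use X in \<open>simp add: M_def\<close>)
  ultimately have "\<not> card (X - insert i M) \<le> 1" using X by linarith
  then obtain p q where pq: "p \<in> X - insert i M" "q \<in> X - insert i M" "p \<noteq> q"
    using X by (metis One_nat_def card_le_Suc0_iff_eq finite_Diff)
  then have "v p = - v i" "v q = - v i" by (auto simp: M_def)
  then show False using star[of z i p q] z i pq vi by fastforce
qed

text \<open>Fixing an element \<open>p\<close> of \<open>J\<close> replaces \<open>u\<close> by \<open>A \<mapsto> u A + u (insert p A)\<close> and \<open>m\<close> by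
  \<open>m - 1\<close>. If \<open>2 \<le> card A < m\<close> and \<open>u A \<noteq> 0\<close>, then \<open>u (insert p A) \<noteq> 0\<close> for all \<open>p \<notin> A\<close>, and
  three of the sets \<open>insert p A\<close> cross pairwise.\<close>

lemma weights_from_constant_subset_sums:
  fixes u :: "'a set \<Rightarrow> real"
  assumes "finite X" "1 \<le> m" "2 * m < card X"
    and "\<And>J. J \<subseteq> X \<Longrightarrow> card J = m \<Longrightarrow> (\<Sum>A\<in>Pow J - {{}}. u A) = c"
    and "\<And>A B C. A \<subseteq> X \<Longrightarrow> B \<subseteq> X \<Longrightarrow> C \<subseteq> X \<Longrightarrow> u A \<noteq> 0 \<Longrightarrow> u B \<noteq> 0 \<Longrightarrow> u C \<noteq> 0 \<Longrightarrow>
              \<not> (crossing A B \<and> crossing A C \<and> crossing B C)"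
  shows "(\<forall>i\<in>X. u {i} = c / real m) \<and> (\<forall>A. A \<subseteq> X \<longrightarrow> 2 \<le> card A \<longrightarrow> card A \<le> m \<longrightarrow> u A = 0)"
  using assms(2,1,3-)
proof (induction m arbitrary: X u c rule: nat_induct_at_least)
  case base
  have "u {i} = c" if "i \<in> X" for i
  proof -
    have "Pow {i} - {{}} = {{i}}" by auto
    then show ?thesis using base(3)[of "{i}"] that by simp
  qed
  then show ?case by auto
next
  case (Suc m)
  note fin = Suc.prems(1) and big = Suc.prems(2) and sums = Suc.prems(3) and cr = Suc.prems(4)
  have link: "(\<forall>i\<in>X - {p}. u {i} + u (insert p {i}) = (c - u {p}) / real m) \<and>
      (\<forall>A. A \<subseteq> X - {p} \<longrightarrow> 2 \<le> card A \<longrightarrow> card A \<le> m \<longrightarrow> u A + u (insert p A) = 0)"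
    if p: "p \<in> X" for p
  proof (rule Suc.IH)
    show "finite (X - {p})" using fin by simp
    show "2 * m < card (X - {p})" using big p fin by simp
    fix J assume J: "J \<subseteq> X - {p}" "card J = m"
    then have fJ: "finite J" using fin by (meson finite_Diff finite_subset)
    have pJ: "p \<notin> J" using J by auto
    have "(\<Sum>A\<in>Pow (insert p J) - {{}}. u A) = c"
      by (rule sums) (use J p fJ in \<open>auto simp: card_insert_if\<close>)
    then show "(\<Sum>A\<in>Pow J - {{}}. u A + u (insert p A)) = c - u {p}"
      using sum_nonempty_subsets_insert[OF fJ pJ, of u] by linarith
  next
    fix A B C assume ABC: "A \<subseteq> X - {p}" "B \<subseteq> X - {p}" "C \<subseteq> X - {p}"
      and nz: "u A + u (insert p A) \<noteq> 0" "u B + u (insert p B) \<noteq> 0" "u C + u (insert p C) \<noteq> 0"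
    \<comment> \<open>If the combined weight is nonzero, one of the two sets has nonzero weight. As
      deleting \<open>p\<close> cannot create a crossing, the condition on triples is
      inherited.\<close>
    have ex: "\<exists>Z'\<subseteq>X. u Z' \<noteq> 0 \<and> Z' - {p} = Z" if "Z \<subseteq> X - {p}" "u Z + u (insert p Z) \<noteq> 0" for Z
    proof (cases "u Z = 0")
      case True then show ?thesis using that p by (intro exI[of _ "insert p Z"]) auto
    next
      case False then show ?thesis using that by (intro exI[of _ Z]) auto
    qed
    obtain A' B' C' where *: "A' \<subseteq> X" "B' \<subseteq> X" "C' \<subseteq> X" "u A' \<noteq> 0" "u B' \<noteq> 0" "u C' \<noteq> 0"
      "A = A' - {p}" "B = B' - {p}" "C = C' - {p}"
      using ex[OF ABC(1) nz(1)] ex[OF ABC(2) nz(2)] ex[OF ABC(3) nz(3)] by auto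
    have mono: "crossing (Y - {p}) (Z - {p}) \<Longrightarrow> crossing Y Z" for Y Z
      unfolding crossing_def by blast
    show "\<not> (crossing A B \<and> crossing A C \<and> crossing B C)"
      using cr[OF *(1-6)] mono unfolding * by blast
  qed
  have small: "u A = 0" if A: "A \<subseteq> X" "2 \<le> card A" "card A \<le> m" for A
  proof (rule ccontr)
    assume nz: "u A \<noteq> 0"
    have ins: "u (insert p A) \<noteq> 0" if "p \<in> X - A" for p
    proof -
      have "u A + u (insert p A) = 0" using link[of p] A that by blast
      then show ?thesis using nz by linarith
    qed
    have fA: "finite A" using A fin finite_subset by auto
    have "3 \<le> card (X - A)" using A fA big Suc.hyps by (simp add: card_Diff_subset)
    then obtain p q r where pqr: "p \<in> X - A" "q \<in> X - A" "r \<in> X - A" "p \<noteq> q" "p \<noteq> r" "q \<noteq> r"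
      using obtain_three_distinct[of "X - A"] fin by blast
    obtain a where "a \<in> A" using A by fastforce
    then show False
      using cr[of "insert p A" "insert q A" "insert r A"] ins pqr A by (auto simp: crossing_def)
  qed
  \<comment> \<open>Deleting a point \<open>p\<close> of \<open>A\<close> gives a set covered by
    \<open>small\<close>, and the relation at \<open>p\<close> carries the vanishing over to
    \<open>A\<close>.\<close>
  have large: "u A = 0" if A: "A \<subseteq> X" "3 \<le> card A" "card A \<le> Suc m" for A
  proof -
    obtain p where p: "p \<in> A" using A by fastforce
    have fA: "finite A" using A fin finite_subset by auto
    have *: "A - {p} \<subseteq> X - {p}" "2 \<le> card (A - {p})" "card (A - {p}) \<le> m"
      using A p fA by auto
    then have "u (A - {p}) + u (insert p (A - {p})) = 0" "u (A - {p}) = 0"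
      using link[of p] small[of "A - {p}"] A p by blast+
    then show ?thesis using p by (simp add: insert_absorb)
  qed
  show ?case
  proof (cases "m = 1")
    case True
    \<comment> \<open>For \<open>m = 1\<close> no size lies between 2 and \<open>m\<close>, so
      \<open>small\<close> says nothing and pairs need the graph argument. The shift by
      \<open>c / 2\<close> brings \<open>u {i} + u {j} + u {i, j} = c\<close> into symmetric
      form.\<close>
    define v where "v i = u {i} - c / 2" for i
    have pair: "u {i, j} = - (v i + v j)" if "i \<in> X" "j \<in> X" "i \<noteq> j" for i j
    proof -
      have "u {j} + u (insert i {j}) = (c - u {i}) / real m" using link[of i] that by blast
      then have "u {j} + u (insert i {j}) = c - u {i}" using True by simp
      then show ?thesis unfolding v_def by (simp add: field_simps)
    qed
    have v0: "v i = 0" if "i \<in> X" for i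
    proof (rule pair_weights_vanish[where F = "{A. A \<subseteq> X \<and> u A \<noteq> 0}" and X = X])
      show "5 \<le> card X" using big True by simp
      show "{i, j} \<in> {A. A \<subseteq> X \<and> u A \<noteq> 0}" if "i \<in> X" "j \<in> X" "i \<noteq> j" "v i + v j \<noteq> 0" for i j
        using pair[of i j] that by auto
      show "\<not> (crossing A B \<and> crossing A C \<and> crossing B C)"
        if "A \<in> {A. A \<subseteq> X \<and> u A \<noteq> 0}" "B \<in> {A. A \<subseteq> X \<and> u A \<noteq> 0}"
          "C \<in> {A. A \<subseteq> X \<and> u A \<noteq> 0}" for A B C
        using cr[of A B C] that by blast
    qed (use fin that in auto)
    have "u A = 0" if A: "A \<subseteq> X" "2 \<le> card A" "card A \<le> Suc m" for A
    proof -
      have "card A = 2" using A True by simp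
      then obtain i j where "A = {i, j}" "i \<noteq> j" by (auto simp: card_2_iff)
      then show ?thesis using pair[of i j] v0 A by auto
    qed
    then show ?thesis using v0 True by (auto simp: v_def)
  next
    case False
    then have m: "2 \<le> m" using Suc.hyps by simp
    \<comment> \<open>Pairs vanish by \<open>small\<close>, so the relation at \<open>p\<close> ties
      \<open>u {i}\<close> to \<open>u {p}\<close>; comparing through a third element makes all
      singleton weights equal.\<close>
    have rel: "u {i} * real m = c - u {p}" if "i \<in> X" "p \<in> X" "i \<noteq> p" for i p
    proof -
      have "u {p, i} = 0" using small[of "{p, i}"] m that by simp
      moreover have "u {i} + u {p, i} = (c - u {p}) / real m" using link[of p] that by blast
      ultimately show ?thesis using m by (simp add: field_simps)
    qed
    have "u {i} = c / real (Suc m)" if i: "i \<in> X" for i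
    proof -
      have "3 \<le> card X" using big m by simp
      then have "\<not> card (X - {i}) \<le> Suc 0" using i fin by simp
      then obtain p q where pq: "p \<in> X - {i}" "q \<in> X - {i}" "p \<noteq> q"
        using fin by (metis card_le_Suc0_iff_eq finite_Diff)
      have "u {p} * real m = u {i} * real m" using rel[of p q] rel[of i q] i pq by auto
      then have "u {p} = u {i}" using m by simp
      moreover have "u {i} * real m = c - u {p}" using rel[of i p] i pq by auto
      ultimately show ?thesis by (simp add: field_simps)
    qed
    moreover have "u A = 0" if "A \<subseteq> X" "2 \<le> card A" "card A \<le> Suc m" for A
      using small[of A] large[of A] that m by (cases "card A = 2") auto
    ultimately show ?thesis by blast
  qed
qed

section \<open>Sums of weights over the splits of a set\<close>

definition splits :: "'a set \<Rightarrow> 'a set \<Rightarrow> bool" where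
  "splits S I \<longleftrightarrow> I \<inter> S \<noteq> {} \<and> I - S \<noteq> {}"

text \<open>One of the four parts into which \<open>A\<close> and \<open>B\<close> cut
  \<open>X\<close> is empty. This is the classical compatibility of splits, unchanged when a side is
  replaced by its complement.\<close>

definition compatible :: "'a set \<Rightarrow> 'a set \<Rightarrow> 'a set \<Rightarrow> bool" where
  "compatible X A B \<longleftrightarrow>
     X \<inter> A \<inter> B = {} \<or> X \<inter> A \<subseteq> B \<or> X \<inter> B \<subseteq> A \<or> X \<subseteq> A \<union> B"

text \<open>Splits are indexed rather than collected in a set, since the same split may occur at
  several indices, in particular in two different trees.\<close>

definition split_sum :: "'b set \<Rightarrow> ('b \<Rightarrow> 'a set) \<Rightarrow> ('b \<Rightarrow> real) \<Rightarrow> 'a set \<Rightarrow> real" where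
  "split_sum E S w I = (\<Sum>e\<in>E. if splits (S e) I then w e else 0)"

lemma compatible_subset: "compatible X A B \<Longrightarrow> Y \<subseteq> X \<Longrightarrow> compatible Y A B"
  unfolding compatible_def by blast

lemma split_sum_diff:
  assumes "finite E" "J \<subseteq> I"
  shows "split_sum E S w I - split_sum E S w J
    = (\<Sum>e\<in>E. if splits (S e) I \<and> \<not> splits (S e) J then w e else 0)"
  unfolding split_sum_def sum_subtractf[symmetric]
  by (rule sum.cong) (use assms in \<open>auto simp: splits_def\<close>)

text \<open>Every split has a side with at most \<open>card X - k\<close> elements, and
  \<open>card X < 2 * k\<close> makes two such sides too small to cover \<open>X\<close>. Compatible
  small sides therefore do not cross, and the lemma on subset sums applies with the complements of
  \<open>k\<close>-sets as the sets \<open>J\<close>.\<close>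

lemma split_sum_vanishes_below_half:
  fixes w :: "'b \<Rightarrow> real"
  assumes E: "finite E" and X: "finite X" and k: "k < card X" "card X < 2 * k"
    and large_side: "\<And>e. e \<in> E \<Longrightarrow> k \<le> card (X \<inter> S e) \<or> k \<le> card (X - S e)"
    and three: "\<And>a b c. a \<in> E \<Longrightarrow> b \<in> E \<Longrightarrow> c \<in> E \<Longrightarrow>
      compatible X (S a) (S b) \<or> compatible X (S a) (S c) \<or> compatible X (S b) (S c)"
    and zero: "\<And>I. I \<subseteq> X \<Longrightarrow> card I = k \<Longrightarrow> split_sum E S w I = 0"
    and I: "I \<subseteq> X"
  shows "split_sum E S w I = 0"
proof -
  define m where "m = card X - k"
  define small where "small e = (if k \<le> card (X - S e) then X \<inter> S e else X - S e)" for e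
  define u where "u A = (\<Sum>e\<in>{e\<in>E. small e = A}. w e)" for A
  have small_sub: "small e \<subseteq> X" for e by (auto simp: small_def)
  have card_small: "card (small e) \<le> m" if "e \<in> E" for e
  proof -
    have "card X = card (X \<inter> S e) + card (X - S e)"
      using card_Int_Diff[OF X, of "S e"] .
    then show ?thesis using large_side[OF that] by (auto simp: small_def m_def)
  qed
  have splits_small: "splits (S e) J = splits (small e) J" if "J \<subseteq> X" for e J
    using that unfolding splits_def small_def by (cases "k \<le> card (X - S e)") auto
  have group: "(\<Sum>e\<in>E. if P (small e) then w e else 0) = (\<Sum>A\<in>Pow X. if P A then u A else 0)" for P
  proof -
    have "(\<Sum>e\<in>E. if P (small e) then w e else 0)
        = (\<Sum>A\<in>Pow X. \<Sum>e\<in>{e\<in>E. small e = A}. if P (small e) then w e else 0)"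
      by (rule sum.group[symmetric]) (use E X small_sub in auto)
    also have "\<dots> = (\<Sum>A\<in>Pow X. if P A then u A else 0)"
      by (rule sum.cong) (auto simp: u_def intro!: sum.neutral)
    finally show ?thesis .
  qed
  have as_u: "split_sum E S w J = (\<Sum>A\<in>Pow X. if splits A J then u A else 0)" if "J \<subseteq> X" for J
    unfolding split_sum_def splits_small[OF that] by (rule group)
  have u_big: "u A = 0" if "m < card A" for A
    unfolding u_def by (rule sum.neutral) (use card_small that in force)
  define c where "c = split_sum E S w X"
  have weights: "(\<forall>i\<in>X. u {i} = c / real m) \<and>
      (\<forall>A. A \<subseteq> X \<longrightarrow> 2 \<le> card A \<longrightarrow> card A \<le> m \<longrightarrow> u A = 0)"
  proof (rule weights_from_constant_subset_sums)
    show "finite X" by fact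
    show "1 \<le> m" "2 * m < card X" using k by (auto simp: m_def)
  next
    fix J assume J: "J \<subseteq> X" "card J = m"
    have fJ: "finite J" using J X finite_subset by auto
    have cJ: "card (X - J) = k" using J X fJ k by (simp add: card_Diff_subset m_def)
    \<comment> \<open>\<open>X - J\<close> has \<open>k > m\<close> elements and fits into no small
      side, so a split of \<open>X\<close> fails to split \<open>X - J\<close> exactly when its
      small side lies inside \<open>J\<close>.\<close>
    have iff: "(splits A X \<and> \<not> splits A (X - J)) = (A \<in> Pow J - {{}})" if A: "A \<subseteq> X" "card A \<le> m" for A
    proof -
      have "A \<noteq> X" using A k by (auto simp: m_def)
      moreover have "\<not> X - J \<subseteq> A"
        using card_mono[of A "X - J"] A finite_subset[OF A(1) X] cJ k by (auto simp: m_def)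
      ultimately show ?thesis using A unfolding splits_def by auto
    qed
    have "split_sum E S w X - split_sum E S w (X - J)
        = (\<Sum>e\<in>E. if splits (small e) X \<and> \<not> splits (small e) (X - J) then w e else 0)"
      using split_sum_diff[OF E, of "X - J" X S w] splits_small by auto
    also have "\<dots> = (\<Sum>e\<in>E. if small e \<in> Pow J - {{}} then w e else 0)"
      by (rule sum.cong) (use iff small_sub card_small in auto)
    also have "\<dots> = (\<Sum>A\<in>Pow X. if A \<in> Pow J - {{}} then u A else 0)"
      by (rule group)
    also have "\<dots> = (\<Sum>A\<in>Pow X \<inter> (Pow J - {{}}). u A)"
      using X by (simp add: sum.inter_restrict[symmetric] del: Diff_iff)
    also have "Pow X \<inter> (Pow J - {{}}) = Pow J - {{}}" using J by auto
    finally show "(\<Sum>A\<in>Pow J - {{}}. u A) = c"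
      using zero[of "X - J"] cJ by (simp add: c_def)
  next
    fix A B C assume nz: "u A \<noteq> 0" "u B \<noteq> 0" "u C \<noteq> 0"
    have ex: "\<exists>e\<in>E. small e = Z" if "u Z \<noteq> 0" for Z
      using that unfolding u_def by (metis (mono_tags, lifting) empty_Collect_eq sum.empty)
    obtain e f g where efg: "e \<in> E" "f \<in> E" "g \<in> E" "small e = A" "small f = B" "small g = C"
      using ex[OF nz(1)] ex[OF nz(2)] ex[OF nz(3)] by blast
    have nc: "\<not> crossing (small a) (small b)" if ab: "a \<in> E" "b \<in> E" "compatible X (S a) (S b)" for a b
    proof -
      have "card (small a \<union> small b) < card X"
        using card_Un_le[of "small a" "small b"] card_small[of a] card_small[of b] ab k
        by (simp add: m_def)
      then have "small a \<union> small b \<noteq> X" by auto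
      then have "\<not> X \<subseteq> small a \<union> small b" using small_sub by blast
      moreover have "compatible X (small a) (small b)"
        using ab(3) unfolding compatible_def small_def by (auto split: if_splits)
      ultimately show ?thesis using small_sub[of a] small_sub[of b]
        unfolding crossing_def compatible_def by blast
    qed
    show "\<not> (crossing A B \<and> crossing A C \<and> crossing B C)"
      using three[of e f g] nc efg by blast
  qed
  \<comment> \<open>Only singletons can contribute, each with weight \<open>c / m\<close>. Hence
    \<open>c = card X * c / m\<close>, which forces \<open>c = 0\<close> because \<open>m\<close>
    differs from \<open>card X\<close>.\<close>
  have "c = (\<Sum>A\<in>Pow X. if splits A X then u A else 0)"
    unfolding c_def by (rule as_u) simp
  also have "\<dots> = (\<Sum>A\<in>(\<lambda>i. {i}) ` X. u A)"
  proof (rule sum.mono_neutral_cong_right)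
    show "\<forall>A\<in>Pow X - (\<lambda>i. {i}) ` X. (if splits A X then u A else 0) = 0"
    proof
      fix A assume A: "A \<in> Pow X - (\<lambda>i. {i}) ` X"
      then have fA: "finite A" using X finite_subset by auto
      have "card A \<noteq> 1" using A by (auto simp: card_1_singleton_iff)
      moreover have "card A = 0 \<Longrightarrow> \<not> splits A X" using fA by (auto simp: splits_def)
      moreover have "2 \<le> card A \<Longrightarrow> u A = 0"
        using weights u_big[of A] A by (cases "card A \<le> m") auto
      ultimately show "(if splits A X then u A else 0) = 0" by (cases "2 \<le> card A") auto
    qed
    have "X \<noteq> {x}" for x using k by auto
    then show "\<And>A. A \<in> (\<lambda>i. {i}) ` X \<Longrightarrow> (if splits A X then u A else 0) = u A"
      unfolding splits_def by auto
  qed (use X in auto)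
  also have "\<dots> = (\<Sum>i\<in>X. u {i})" by (subst sum.reindex) (auto simp: inj_on_def)
  also have "\<dots> = real (card X) * (c / real m)" using weights by simp
  finally have "c * real m = c * real (card X)" using k by (auto simp: m_def field_simps)
  moreover have "m \<noteq> card X" using k by (auto simp: m_def)
  ultimately have "c = 0" by simp
  have u0: "u A = 0" if A: "A \<subseteq> X" "A \<noteq> {}" for A
  proof -
    have fA: "finite A" using A X finite_subset by auto
    show ?thesis
    proof (cases "card A = 1")
      case True
      then show ?thesis using weights A \<open>c = 0\<close> by (auto simp: card_1_singleton_iff)
    next
      case False
      then have "2 \<le> card A" using fA A by (metis One_nat_def Suc_leI card_gt_0_iff le_neq_implies_less numeral_2_eq_2)
      then show ?thesis using weights u_big[of A] A by (cases "card A \<le> m") auto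
    qed
  qed
  show ?thesis
    unfolding as_u[OF I] by (rule sum.neutral) (use u0 in \<open>auto simp: splits_def\<close>)
qed

lemma split_sum_vanishes_step:
  fixes w :: "'b \<Rightarrow> real"
  assumes E: "finite E" and X: "finite X" "4 \<le> card X"
    and three: "\<And>a b c. a \<in> E \<Longrightarrow> b \<in> E \<Longrightarrow> c \<in> E \<Longrightarrow>
      compatible X (S a) (S b) \<or> compatible X (S a) (S c) \<or> compatible X (S b) (S c)"
    and zero: "\<And>I. I \<subseteq> X \<Longrightarrow> card I = card X - 1 \<or> card I = card X - 2 \<Longrightarrow> split_sum E S w I = 0"
  shows "split_sum E S w X = 0"
proof -
  define side where "side e A \<longleftrightarrow> X \<inter> S e = A \<or> X - S e = A" for e A
  have agree: "(x \<in> S e \<longleftrightarrow> y \<in> S e) \<longleftrightarrow> (x \<in> A \<longleftrightarrow> y \<in> A)"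
    if "side e A" "x \<in> X" "y \<in> X" for e A x y
    using that unfolding side_def by blast
  define s where "s A = (\<Sum>e\<in>E. if side e A then w e else 0)" for A
  define c where "c = split_sum E S w X"
  have single: "s {i} = c" if i: "i \<in> X" for i
  proof -
    have "card (X - {i}) = card X - 1" using i X by simp
    then have "c = split_sum E S w X - split_sum E S w (X - {i})"
      using zero[of "X - {i}"] by (auto simp: c_def)
    also have "\<dots> = s {i}"
      unfolding split_sum_diff[OF E Diff_subset] s_def
    proof (rule sum.cong)
      fix e assume "e \<in> E"
      have "card (X - {i}) \<noteq> 0" using X i by simp
      then have "X - {i} \<noteq> {}" by (metis card.empty)
      then show "(if splits (S e) X \<and> \<not> splits (S e) (X - {i}) then w e else 0)
          = (if side e {i} then w e else 0)"
        using i unfolding splits_def side_def by (intro if_cong) auto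
    qed simp
    finally show ?thesis by simp
  qed
  \<comment> \<open>Removing \<open>i\<close> and \<open>j\<close> loses the splits with side
    \<open>{i}\<close>, \<open>{j}\<close> or \<open>{i, j}\<close>, so
    \<open>c = c + c + s {i, j}\<close>. Elements outside the pair make the three cases
    exclusive.\<close>
  have pair: "s {i, j} = - c" if ij: "i \<in> X" "j \<in> X" "i \<noteq> j" for i j
  proof -
    have cij: "card (X - {i, j}) = card X - 2" using ij X by (simp add: card_Diff_subset)
    then have "c = split_sum E S w X - split_sum E S w (X - {i, j})"
      using zero[of "X - {i, j}"] by (auto simp: c_def)
    also have "\<dots> = (\<Sum>e\<in>E. (if side e {i} then w e else 0) + (if side e {j} then w e else 0)
        + (if side e {i, j} then w e else 0))"
      unfolding split_sum_diff[OF E Diff_subset]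
    proof (rule sum.cong)
      fix e assume "e \<in> E"
      have "\<not> card (X - {i, j}) \<le> Suc 0" using cij X by simp
      then obtain p q where pq: "p \<in> X - {i, j}" "q \<in> X - {i, j}" "p \<noteq> q"
        using X by (metis card_le_Suc0_iff_eq finite_Diff)
      have excl: "\<not> (side e {i} \<and> side e {j})" "\<not> (side e {i} \<and> side e {i, j})"
        "\<not> (side e {j} \<and> side e {i, j})"
        using agree[of e _ i p] agree[of e _ i j] pq ij by blast+
      have "(splits (S e) X \<and> \<not> splits (S e) (X - {i, j})) = (side e {i} \<or> side e {j} \<or> side e {i, j})"
      proof
        assume "splits (S e) X \<and> \<not> splits (S e) (X - {i, j})"
        then consider "X \<inter> S e \<noteq> {}" "X \<inter> S e \<subseteq> {i, j}" | "X - S e \<noteq> {}" "X - S e \<subseteq> {i, j}"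
          unfolding splits_def by blast
        then show "side e {i} \<or> side e {j} \<or> side e {i, j}"
          unfolding side_def by cases (metis subset_insert_iff subset_singletonD Diff_insert0 insert_Diff)+
      next
        assume "side e {i} \<or> side e {j} \<or> side e {i, j}"
        then obtain A where A: "side e A" "A \<subseteq> {i, j}" "i \<in> A \<or> j \<in> A" by blast
        have "splits (S e) X"
          using agree[OF A(1), of i p] agree[OF A(1), of j p] A(2,3) pq ij unfolding splits_def by blast
        moreover have "x \<in> S e \<longleftrightarrow> y \<in> S e" if "x \<in> X - {i, j}" "y \<in> X - {i, j}" for x y
          using agree[OF A(1), of x y] A(2) that by blast
        ultimately show "splits (S e) X \<and> \<not> splits (S e) (X - {i, j})"
          unfolding splits_def by blast
      qed
      then show "(if splits (S e) X \<and> \<not> splits (S e) (X - {i, j}) then w e else 0)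
          = (if side e {i} then w e else 0) + (if side e {j} then w e else 0)
            + (if side e {i, j} then w e else 0)"
        using excl by auto
    qed simp
    also have "\<dots> = s {i} + s {j} + s {i, j}" by (simp add: s_def sum.distrib)
    finally show ?thesis using single ij by simp
  qed
  obtain a where a: "a \<in> X" using X by fastforce
  then have "3 \<le> card (X - {a})" using X by simp
  then obtain p q r where pqr: "p \<in> X - {a}" "q \<in> X - {a}" "r \<in> X - {a}" "p \<noteq> q" "p \<noteq> r" "q \<noteq> r"
    using obtain_three_distinct[of "X - {a}"] X by blast
  have ex: "\<exists>e\<in>E. side e {a, i}" if "i \<in> X - {a}" "c \<noteq> 0" for i
  proof (rule ccontr)
    assume "\<not> ?thesis"
    then have "s {a, i} = 0" unfolding s_def by (intro sum.neutral) auto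
    then show False using pair[of a i] a that by auto
  qed
  \<comment> \<open>With a fourth element \<open>z\<close>, all four parts are inhabited:
    \<open>a\<close>, \<open>x\<close>, \<open>y\<close> and \<open>z\<close> lie in different
    ones.\<close>
  have incomp: "\<not> compatible X (S e) (S f)"
    if "side e {a, x}" "side f {a, y}" "x \<in> X - {a}" "y \<in> X - {a}" "x \<noteq> y" for e f x y
  proof -
    have "card {a, x, y} \<le> 3" by (simp add: card_insert_if)
    then have "card (X - {a, x, y}) \<noteq> 0" using X that a by (simp add: card_Diff_subset)
    then have "X - {a, x, y} \<noteq> {}" by (metis card.empty)
    then obtain z where z: "z \<in> X" "z \<notin> {a, x, y}" by auto
    have "(a \<in> S e) = (x \<in> S e)" "(a \<in> S e) \<noteq> (z \<in> S e)" "(a \<in> S e) \<noteq> (y \<in> S e)"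
      "(a \<in> S f) = (y \<in> S f)" "(a \<in> S f) \<noteq> (z \<in> S f)" "(a \<in> S f) \<noteq> (x \<in> S f)"
      using agree[OF that(1)] agree[OF that(2)] that(3-) a z by blast+
    then show ?thesis using that a z unfolding compatible_def by blast
  qed
  show ?thesis
  proof (rule ccontr)
    assume "split_sum E S w X \<noteq> 0"
    then have c: "c \<noteq> 0" by (simp add: c_def)
    obtain e f g where "e \<in> E" "f \<in> E" "g \<in> E" "side e {a, p}" "side f {a, q}" "side g {a, r}"
      using ex[OF pqr(1) c] ex[OF pqr(2) c] ex[OF pqr(3) c] by blast
    then show False using three[of e f g] incomp pqr by metis
  qed
qed

lemma split_sum_vanishes:
  fixes w :: "'b \<Rightarrow> real"
  assumes E: "finite E" and X: "finite X" and k: "2 \<le> k" "k < card X"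
    and large_side: "\<And>e. e \<in> E \<Longrightarrow> k \<le> card (X \<inter> S e) \<or> k \<le> card (X - S e)"
    and three: "\<And>a b c. a \<in> E \<Longrightarrow> b \<in> E \<Longrightarrow> c \<in> E \<Longrightarrow>
      compatible X (S a) (S b) \<or> compatible X (S a) (S c) \<or> compatible X (S b) (S c)"
    and zero: "\<And>I. I \<subseteq> X \<Longrightarrow> card I = k \<Longrightarrow> split_sum E S w I = 0"
  shows "split_sum E S w X = 0"
proof (cases "card X < 2 * k")
  case True
  show ?thesis
    by (rule split_sum_vanishes_below_half[where k = k and X = X]) (use assms True in auto)
next
  case False
  have three_sub: "compatible Y (S a) (S b) \<or> compatible Y (S a) (S c) \<or> compatible Y (S b) (S c)"
    if "a \<in> E" "b \<in> E" "c \<in> E" "Y \<subseteq> X" for a b c Y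
    using three[of a b c] that compatible_subset by blast
  \<comment> \<open>\<open>I\<close> is enlarged to a set \<open>Y\<close> of
    \<open>2 * k - 1\<close> elements. Then \<open>k < card Y < 2 * k\<close> because
    \<open>2 \<le> k\<close>, and by pigeonhole any split of \<open>Y\<close> has a side with at
    least \<open>k\<close> elements.\<close>
  have low: "split_sum E S w I = 0" if I: "I \<subseteq> X" "card I \<le> 2 * k - 1" for I
  proof -
    have "\<exists>Y. I \<subseteq> Y \<and> Y \<subseteq> X \<and> card Y = 2 * k - 1"
      using exists_subset_between[of I "2 * k - 1" X] I X False by auto
    then obtain Y where Y: "I \<subseteq> Y" "Y \<subseteq> X" "card Y = 2 * k - 1" by blast
    have fY: "finite Y" using Y X finite_subset by auto
    show ?thesis
    proof (rule split_sum_vanishes_below_half[where k = k and X = Y, OF E fY])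
      show "k \<le> card (Y \<inter> S e) \<or> k \<le> card (Y - S e)" for e
        using card_Int_Diff[OF fY, of "S e"] Y(3) by linarith
    qed (use three_sub zero Y k in auto)
  qed
  \<comment> \<open>Beyond \<open>2 * k - 1\<close> the sizes are at least 4, and strong induction
    supplies the two smaller sizes that the step lemma needs.\<close>
  have "\<forall>I. I \<subseteq> X \<and> card I = j \<longrightarrow> split_sum E S w I = 0" for j
  proof (induction j rule: less_induct)
    case (less j)
    show ?case
    proof (cases "j \<le> 2 * k - 1")
      case True then show ?thesis using low by auto
    next
      case False
      show ?thesis
      proof (intro allI impI)
        fix I assume I: "I \<subseteq> X \<and> card I = j"
        show "split_sum E S w I = 0"
        proof (rule split_sum_vanishes_step[OF E])
          show "finite I" using I X finite_subset by auto
          show "4 \<le> card I" using I False k by linarith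
          show "split_sum E S w I' = 0" if "I' \<subseteq> I" "card I' = card I - 1 \<or> card I' = card I - 2" for I'
            using less.IH[of "card I'"] that I False k by fastforce
        qed (use three_sub I in auto)
      qed
    qed
  qed
  then show ?thesis by blast
qed

section \<open>Separating edges of a tree\<close>

definition joined :: "'v set set \<Rightarrow> 'v \<Rightarrow> 'v \<Rightarrow> bool" where
  "joined E x y \<longleftrightarrow> (x, y) \<in> (adj E)\<^sup>*"

lemma joined_refl [simp]: "joined E x x"
  by (simp add: joined_def)

lemma joined_trans: "joined E x y \<Longrightarrow> joined E y z \<Longrightarrow> joined E x z"
  unfolding joined_def by (rule rtrancl_trans)

lemma joined_sym: "joined E x y \<Longrightarrow> joined E y x"
proof -
  have "sym (adj E)" by (auto simp: sym_def adj_def insert_commute)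
  then show "joined E x y \<Longrightarrow> joined E y x"
    unfolding joined_def by (meson symD sym_rtrancl)
qed

lemma joined_common: "joined E v x \<Longrightarrow> joined E v y \<Longrightarrow> joined E x y"
  by (rule joined_trans[OF joined_sym])

lemma joined_mono: "joined E x y \<Longrightarrow> E \<subseteq> F \<Longrightarrow> joined F x y"
  unfolding joined_def using rtrancl_mono[of "adj E" "adj F"] by (auto simp: adj_def)

lemma joined_edge: "{x, y} \<in> E \<Longrightarrow> joined E x y"
  unfolding joined_def by (auto simp: adj_def)

text \<open>A walk can be shortened until it uses the added edge at most once; the last two cases
  are the two directions of crossing it.\<close>

lemma joined_insert:
  assumes "joined (insert {u, v} E) x y"
  shows "joined E x y \<or> joined E x u \<and> joined E v y \<or> joined E x v \<and> joined E u y"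
  using assms unfolding joined_def
proof (induction rule: rtrancl_induct)
  case base
  then show ?case by simp
next
  case (step y z)
  from step.hyps(2) consider "(y, z) \<in> adj E" | "y = u" "z = v" | "y = v" "z = u"
    by (auto simp: adj_def doubleton_eq_iff)
  then show ?case
    using step.IH by cases (auto intro: rtrancl_into_rtrancl)
qed

lemma joined_isolated:
  assumes "joined E x y" "\<And>e. e \<in> E \<Longrightarrow> x \<notin> e"
  shows "x = y"
  using assms(1) unfolding joined_def
  by (induction rule: rtrancl_induct) (use assms(2) in \<open>auto simp: adj_def\<close>)

lemma joined_path:
  assumes "joined E x y"
  obtains p where "p \<noteq> []" "hd p = x" "last p = y" "distinct p"
    "\<And>i. Suc i < length p \<Longrightarrow> {p ! i, p ! Suc i} \<in> E"
proof -
  have "\<exists>p. p \<noteq> [] \<and> hd p = x \<and> last p = y \<and> distinct p \<and>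
      (\<forall>i. Suc i < length p \<longrightarrow> {p ! i, p ! Suc i} \<in> E)"
    using assms unfolding joined_def
  proof (induction rule: rtrancl_induct)
    case base
    show ?case by (rule exI[of _ "[x]"]) simp
  next
    case (step y z)
    then obtain p where p: "p \<noteq> []" "hd p = x" "last p = y" "distinct p"
      "\<And>i. Suc i < length p \<Longrightarrow> {p ! i, p ! Suc i} \<in> E" by blast
    show ?case
    proof (cases "z \<in> set p")
      \<comment> \<open>If \<open>z\<close> was already visited, the path is cut at its occurrence,
        which keeps the vertices distinct.\<close>
      case True
      then obtain j where j: "j < length p" "p ! j = z" by (auto simp: in_set_conv_nth)
      show ?thesis
      proof (rule exI[of _ "take (Suc j) p"], intro conjI)
        have "last (take (Suc j) p) = p ! j" using j by (simp add: take_Suc_conv_app_nth)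
        then show "last (take (Suc j) p) = z" using j by simp
      qed (use j p in auto)
    next
      case False
      have "{(p @ [z]) ! i, (p @ [z]) ! Suc i} \<in> E" if "Suc i < length (p @ [z])" for i
      proof (cases "Suc i < length p")
        case True
        then show ?thesis using p(5)[of i] by (simp add: nth_append)
      next
        case False
        then have "i = length p - 1" "Suc i = length p" using that by auto
        then show ?thesis using p(1,3) step.hyps(2)
          by (auto simp: nth_append last_conv_nth adj_def)
      qed
      then show ?thesis by (intro exI[of _ "p @ [z]"]) (use False p in auto)
    qed
  qed
  then show ?thesis using that by blast
qed

section \<open>Edges of a tree as bridges\<close>

lemma tree_edgeE:
  assumes "is_tree T" "e \<in> edges T"
  obtains u v where "e = {u, v}" "u \<noteq> v" "u \<in> verts T" "v \<in> verts T"
  using assms unfolding is_tree_def simple_graph_def nsets_def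
  by (auto simp: card_2_iff)

lemma tree_edge_endpointE:
  assumes "is_tree T" "e \<in> edges T" "u \<in> e"
  obtains v where "e = {u, v}" "u \<noteq> v" "u \<in> verts T" "v \<in> verts T"
  by (rule tree_edgeE[OF assms(1,2)]) (use assms(3) that in \<open>auto simp: insert_commute\<close>)

lemma tree_finite:
  assumes "is_tree T"
  shows "finite (verts T)" "finite (edges T)"
proof -
  show "finite (verts T)" using assms by (auto simp: is_tree_def simple_graph_def)
  moreover have "edges T \<subseteq> Pow (verts T)"
    using assms by (auto simp: is_tree_def simple_graph_def nsets_def)
  ultimately show "finite (edges T)" by (meson finite_Pow_iff finite_subset)
qed

lemma tree_joined: "is_tree T \<Longrightarrow> x \<in> verts T \<Longrightarrow> y \<in> verts T \<Longrightarrow> joined (edges T) x y"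
  by (auto simp: is_tree_def connected_graph_def joined_def)

text \<open>A simple path from \<open>u\<close> to \<open>v\<close> avoiding the edge would close up
  with it to a cycle.\<close>

lemma tree_edge_is_bridge:
  assumes T: "is_tree T" and e: "{u, v} \<in> edges T"
  shows "\<not> joined (edges T - {{u, v}}) u v"
proof
  assume "joined (edges T - {{u, v}}) u v"
  then obtain p where p: "p \<noteq> []" "hd p = u" "last p = v" "distinct p"
    "\<And>i. Suc i < length p \<Longrightarrow> {p ! i, p ! Suc i} \<in> edges T - {{u, v}}"
    by (rule joined_path) blast
  have uv: "u \<noteq> v" using tree_edgeE[OF T e] by (metis doubleton_eq_iff)
  \<comment> \<open>One vertex would give \<open>u = v\<close>, and two vertices would make the path
    the deleted edge itself.\<close>
  have len: "3 \<le> length p"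
  proof (rule ccontr)
    assume "\<not> 3 \<le> length p"
    moreover have "length p \<noteq> 0" using p by simp
    ultimately consider "length p = 1" | "length p = 2" by linarith
    then show False
    proof cases
      case 1
      then show False using p uv by (auto simp: length_Suc_conv)
    next
      case 2
      then obtain a b where "p = [a, b]"
        by (metis (no_types, opaque_lifting) One_nat_def length_0_conv length_Suc_conv numeral_2_eq_2)
      then show False using p(2,3) p(5)[of 0] by auto
    qed
  qed
  have "{p ! i, p ! (Suc i mod length p)} \<in> edges T" if i: "i < length p" for i
  proof (cases "Suc i = length p")
    case True
    then have "i = length p - 1" by simp
    then have "p ! i = v" "p ! 0 = u" using p by (auto simp: last_conv_nth hd_conv_nth)
    then show ?thesis using e True by (simp add: insert_commute)
  next
    case False
    then show ?thesis using p(5)[of i] i by auto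
  qed
  then have "graph_cycle T p" using len p by (auto simp: graph_cycle_def)
  then show False using T by (auto simp: is_tree_def)
qed

text \<open>Restoring the edge reconnects everything, so each vertex is joined to \<open>u\<close>
  or \<open>v\<close>; it is not joined to both because the edge is a bridge.\<close>

lemma tree_two_sides:
  assumes T: "is_tree T" and e: "{u, v} \<in> edges T" and x: "x \<in> verts T"
  shows "joined (edges T - {{u, v}}) v x \<longleftrightarrow> \<not> joined (edges T - {{u, v}}) u x"
proof -
  let ?F = "edges T - {{u, v}}"
  have "u \<in> verts T" using tree_edgeE[OF T e] by (metis doubleton_eq_iff)
  then have "joined (insert {u, v} ?F) u x"
    using tree_joined[OF T _ x] e by (metis insert_Diff)
  then have "joined ?F u x \<or> joined ?F v x" using joined_insert by fastforce
  moreover have "\<not> joined ?F u v" by (rule tree_edge_is_bridge[OF T e])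
  ultimately show ?thesis by (meson joined_sym joined_trans)
qed

section \<open>Minimal subtrees and separating edges\<close>

definition separates :: "'v set set \<Rightarrow> 'v set \<Rightarrow> 'v set \<Rightarrow> bool" where
  "separates E e I \<longleftrightarrow> (\<exists>x\<in>I. \<exists>y\<in>I. \<not> joined (E - {e}) x y)"

text \<open>The explicit candidate for the minimal subtree. The vertices of \<open>I\<close> are
  added separately because no edge separates a single vertex.\<close>

definition spanned :: "'v ugraph \<Rightarrow> 'v set \<Rightarrow> 'v ugraph" where
  "spanned T I = \<lparr>verts = I \<union> \<Union>{e \<in> edges T. separates (edges T) e I},
     edges = {e \<in> edges T. separates (edges T) e I}\<rparr>"

text \<open>Take the fewest edges that still join \<open>x\<close> and \<open>y\<close>. Dropping
  one of them, \<open>{u, v}\<close>, leaves \<open>x\<close> with one endpoint and \<open>y\<close>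
  with the other, so any other connection of \<open>x\<close> and \<open>y\<close> in the tree would
  join \<open>u\<close> and \<open>v\<close> around a bridge.\<close>

lemma joined_by_separating_edges:
  assumes T: "is_tree T" and xy: "x \<in> verts T" "y \<in> verts T"
  shows "joined {e \<in> edges T. separates (edges T) e {x, y}} x y"
proof -
  let ?P = "\<lambda>F. F \<subseteq> edges T \<and> joined F x y"
  have "?P (edges T)" using tree_joined[OF T xy] by simp
  then obtain F where F: "?P F" and min: "\<And>F'. ?P F' \<Longrightarrow> card F \<le> card F'"
    using ex_has_least_nat[of ?P "edges T" card] by blast
  have fF: "finite F" using F tree_finite(2)[OF T] finite_subset by auto
  have "separates (edges T) e {x, y}" if e: "e \<in> F" for e
  proof -
    obtain u v where uv: "e = {u, v}" using tree_edgeE[OF T] F e by (metis subsetD)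
    have "card (F - {e}) < card F" using card_Diff1_less[OF fF e] .
    then have "\<not> joined (F - {e}) x y" using min[of "F - {e}"] F by auto
    moreover have "joined (insert {u, v} (F - {e})) x y" using F e uv by (simp add: insert_absorb)
    ultimately have cases: "joined (F - {e}) x u \<and> joined (F - {e}) v y \<or>
        joined (F - {e}) x v \<and> joined (F - {e}) u y"
      using joined_insert by fastforce
    have sub: "joined (F - {e}) a b \<Longrightarrow> joined (edges T - {e}) a b" for a b
      by (erule joined_mono) (use F in auto)
    have "\<not> joined (edges T - {e}) x y"
    proof
      assume "joined (edges T - {e}) x y"
      then have "joined (edges T - {e}) u v"
        using cases sub by (meson joined_sym joined_trans)
      then show False using tree_edge_is_bridge[OF T, of u v] F e uv by auto
    qed
    then show ?thesis unfolding separates_def by blast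
  qed
  then show ?thesis using F by (auto intro: joined_mono)
qed

lemma separates_mono: "separates E e I \<Longrightarrow> I \<subseteq> J \<Longrightarrow> separates E e J"
  unfolding separates_def by blast

lemma subgraph_cycle: "graph_cycle H c \<Longrightarrow> subgraph_of H T \<Longrightarrow> graph_cycle T c"
  unfolding graph_cycle_def subgraph_of_def by blast

lemma spanned_subtree:
  assumes T: "is_tree T" and I: "I \<subseteq> verts T" "I \<noteq> {}"
  shows "subtree_of (spanned T I) T"
proof -
  let ?F = "{e \<in> edges T. separates (edges T) e I}"
  have ev: "e \<subseteq> verts T" if "e \<in> edges T" for e using tree_edgeE[OF T that] by blast
  have sub: "subgraph_of (spanned T I) T"
    using I ev by (auto simp: subgraph_of_def spanned_def)
  have IJ: "joined ?F x y" if "x \<in> I" "y \<in> I" for x y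
  proof (rule joined_mono)
    show "joined {e \<in> edges T. separates (edges T) e {x, y}} x y"
      using that I by (intro joined_by_separating_edges[OF T]) auto
    show "{e \<in> edges T. separates (edges T) e {x, y}} \<subseteq> ?F"
      using that separates_mono[of "edges T" _ "{x, y}" I] by auto
  qed
  \<comment> \<open>An edge separating \<open>x\<close> from \<open>y\<close> lies on every
    connection between them, so its endpoints are reached from \<open>I\<close>.\<close>
  have to_I: "\<exists>x\<in>I. joined ?F x z" if z: "z \<in> verts (spanned T I)" for z
  proof (cases "z \<in> I")
    case True then show ?thesis by (intro bexI[of _ z]) auto
  next
    case False
    then obtain e where e: "e \<in> ?F" "z \<in> e" using z by (auto simp: spanned_def)
    then obtain x y where xy: "x \<in> I" "y \<in> I" "\<not> joined (edges T - {e}) x y"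
      by (auto simp: separates_def)
    obtain u v where uv: "e = {u, v}" using tree_edgeE[OF T] e by (metis (no_types, lifting) mem_Collect_eq)
    have "joined ?F x y" using IJ[OF xy(1,2)] .
    then have "joined (insert {u, v} (?F - {e})) x y" using e uv by (simp add: insert_absorb)
    moreover have "\<not> joined (?F - {e}) x y" using xy(3) joined_mono[of "?F - {e}" x y "edges T - {e}"] by auto
    ultimately have "joined (?F - {e}) x u \<or> joined (?F - {e}) x v"
      using joined_insert by fastforce
    then have "joined ?F x u \<or> joined ?F x v" by (meson Diff_subset joined_mono)
    moreover have "joined ?F u v" using e uv by (intro joined_edge) auto
    ultimately have "joined ?F x u \<and> joined ?F x v" by (meson joined_sym joined_trans)
    then show ?thesis using e uv xy(1) by auto
  qed
  have "connected_graph (spanned T I)"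
    unfolding connected_graph_def
  proof (intro conjI ballI)
    show "verts (spanned T I) \<noteq> {}" using I by (auto simp: spanned_def)
    fix a b assume ab: "a \<in> verts (spanned T I)" "b \<in> verts (spanned T I)"
    obtain x y where xy: "x \<in> I" "y \<in> I" "joined ?F x a" "joined ?F y b"
      using to_I ab by meson
    have "joined ?F x y" using IJ[OF xy(1,2)] .
    then have "joined ?F a b" using xy by (meson joined_sym joined_trans)
    then show "(a, b) \<in> (adj (edges (spanned T I)))\<^sup>*" by (simp add: joined_def spanned_def)
  qed
  moreover have "simple_graph (spanned T I)"
    using T sub finite_subset[of "verts (spanned T I)" "verts T"]
    unfolding is_tree_def simple_graph_def subgraph_of_def
    by (auto simp: nsets_def spanned_def)
  ultimately show ?thesis
    using T sub subgraph_cycle unfolding subtree_of_def is_tree_def by blast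
qed

text \<open>A subtree containing \<open>I\<close> but lacking a separating edge \<open>e\<close>
  would connect \<open>I\<close> inside the tree without \<open>e\<close>.\<close>

lemma spanned_least:
  assumes T: "is_tree T" and H: "subtree_of H T" "I \<subseteq> verts H"
  shows "subgraph_of (spanned T I) H"
proof -
  have "e \<in> edges H" if e: "e \<in> edges T" "separates (edges T) e I" for e
  proof (rule ccontr)
    assume "e \<notin> edges H"
    then have sub: "edges H \<subseteq> edges T - {e}"
      using H by (auto simp: subtree_of_def subgraph_of_def)
    obtain x y where xy: "x \<in> I" "y \<in> I" "\<not> joined (edges T - {e}) x y"
      using e by (auto simp: separates_def)
    have "joined (edges H) x y"
      by (rule tree_joined) (use H xy in \<open>auto simp: subtree_of_def\<close>)
    then show False using joined_mono[OF _ sub] xy by auto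
  qed
  moreover have "e \<subseteq> verts H" if "e \<in> edges H" for e
    using tree_edgeE[of H e] that H by (auto simp: subtree_of_def)
  ultimately show ?thesis using H by (auto simp: subgraph_of_def spanned_def)
qed

lemma subgraph_of_antisym:
  fixes H K :: "'v ugraph"
  shows "subgraph_of H K \<Longrightarrow> subgraph_of K H \<Longrightarrow> H = K"
  unfolding subgraph_of_def by (auto intro: ugraph.equality)

lemma minimal_subtree_eqI:
  assumes "subtree_of H T" "I \<subseteq> verts H"
    and "\<And>H'. subtree_of H' T \<Longrightarrow> I \<subseteq> verts H' \<Longrightarrow> subgraph_of H H'"
  shows "minimal_subtree T I = H"
  unfolding minimal_subtree_def
  by (rule the_equality) (use assms in \<open>auto intro: subgraph_of_antisym\<close>)

lemma minimal_subtree_eq_spanned: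
  assumes "is_tree T" "I \<subseteq> verts T" "I \<noteq> {}"
  shows "minimal_subtree T I = spanned T I"
proof (rule minimal_subtree_eqI)
  show "subtree_of (spanned T I) T" by (rule spanned_subtree[OF assms])
  show "I \<subseteq> verts (spanned T I)" by (simp add: spanned_def)
  show "subgraph_of (spanned T I) H" if "subtree_of H T" "I \<subseteq> verts H" for H
    by (rule spanned_least[OF assms(1) that])
qed

lemma D_sub_eq:
  assumes "is_tree T" "I \<subseteq> verts T" "I \<noteq> {}"
  shows "D_sub (T, w) I = (\<Sum>e\<in>edges T. if separates (edges T) e I then w e else 0)"
  using tree_finite(2)[OF assms(1)]
  by (simp add: D_sub_def minimal_subtree_eq_spanned[OF assms] spanned_def sum.If_cases Int_def)

section \<open>Leaves and the sides of edges\<close>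

lemma leaf_pendant_edge:
  assumes T: "is_tree T" and i: "i \<in> leaves T"
  obtains e where "e \<in> edges T"
    "\<And>I. I \<subseteq> verts T \<Longrightarrow> I \<noteq> {i} \<Longrightarrow> separates (edges T) e I \<longleftrightarrow> i \<in> I"
proof -
  have "card {e \<in> edges T. i \<in> e} = 1" using i by (simp add: leaves_def)
  then obtain e where e: "{e \<in> edges T. i \<in> e} = {e}" by (auto simp: card_1_singleton_iff)
  then have eT: "e \<in> edges T" "i \<in> e" by auto
  obtain v where v: "e = {i, v}" using tree_edge_endpointE[OF T eT] .
  \<comment> \<open>\<open>e\<close> is the only edge at \<open>i\<close>, so deleting it isolates
    \<open>i\<close> and leaves all other vertices joined to \<open>v\<close>. The set
    \<open>{i}\<close> is excepted because no edge separates a single vertex.\<close>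
  have "i \<notin> f" if "f \<in> edges T - {e}" for f
    using e that by blast
  then have alone: "joined (edges T - {e}) i y \<longleftrightarrow> y = i" for y
    using joined_isolated[of "edges T - {e}" i y] by (metis joined_refl)
  have rest: "joined (edges T - {e}) v y" if "y \<in> verts T" "y \<noteq> i" for y
    using tree_two_sides[OF T, of i v y] alone[of y] eT(1) that unfolding v by simp
  have "separates (edges T) e I \<longleftrightarrow> i \<in> I" if I: "I \<subseteq> verts T" "I \<noteq> {i}" for I
  proof
    assume "separates (edges T) e I"
    then obtain x y where xy: "x \<in> I" "y \<in> I" "\<not> joined (edges T - {e}) x y"
      by (auto simp: separates_def)
    then have "x = i \<or> y = i"
      using joined_common[OF rest[of x] rest[of y]] I(1) by blast
    then show "i \<in> I" using xy by blast
  next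
    assume "i \<in> I"
    moreover obtain x where "x \<in> I" "x \<noteq> i" using I \<open>i \<in> I\<close> by auto
    ultimately show "separates (edges T) e I" using alone by (auto simp: separates_def)
  qed
  then show ?thesis using that eT by blast
qed

text \<open>As \<open>f\<close> survives the deletion of \<open>e\<close>, a component missing one
  endpoint of \<open>f\<close> misses both. Its paths never use \<open>f\<close> and remain when
  \<open>f\<close> is deleted instead.\<close>

lemma component_avoiding_edge:
  assumes "f \<in> E" "e \<noteq> f" "a \<in> f" "f = {b, c}" "\<not> joined (E - {e}) u a" "joined (E - {e}) u x"
  shows "joined (E - {f}) u x"
proof -
  have bc: "joined (E - {e}) b c" using assms by (intro joined_edge) auto
  have nb: "\<not> joined (E - {e}) u b" "\<not> joined (E - {e}) u c"
    using assms(3-5) joined_trans[OF _ bc, of u] joined_trans[OF _ joined_sym[OF bc], of u] by auto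
  have sub: "joined (E - {e} - {f}) p q \<Longrightarrow> joined (E - {e}) p q" for p q
    by (erule joined_mono) auto
  have "joined (insert {b, c} (E - {e} - {f})) u x"
    using assms(6) by (rule joined_mono) (use assms in auto)
  then have "joined (E - {e} - {f}) u x" using joined_insert nb sub by metis
  then show ?thesis by (rule joined_mono) auto
qed

text \<open>The endpoint is an arbitrary choice between the two sides; \<open>splits\<close> and
  \<open>compatible\<close> do not change when a side is exchanged for its complement.\<close>

definition edge_side :: "'v set set \<Rightarrow> 'v set \<Rightarrow> 'v set" where
  "edge_side E e = {x. joined (E - {e}) (SOME u. u \<in> e) x}"

lemma edge_sideE:
  assumes T: "is_tree T" and e: "e \<in> edges T"
  obtains u v where "e = {u, v}" "u \<in> verts T" "v \<in> verts T"
    "\<And>x. x \<in> edge_side (edges T) e \<longleftrightarrow> joined (edges T - {e}) u x"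
    "\<And>x. x \<in> verts T \<Longrightarrow> joined (edges T - {e}) v x \<longleftrightarrow> x \<notin> edge_side (edges T) e"
proof -
  define u where "u = (SOME u. u \<in> e)"
  have "u \<in> e" unfolding u_def using tree_edgeE[OF T e] by (metis insertI1 someI)
  then obtain v where v: "e = {u, v}" "u \<in> verts T" "v \<in> verts T"
    by (rule tree_edge_endpointE[OF T e])
  have side: "x \<in> edge_side (edges T) e \<longleftrightarrow> joined (edges T - {e}) u x" for x
    by (simp add: edge_side_def u_def)
  then have "joined (edges T - {e}) v x \<longleftrightarrow> x \<notin> edge_side (edges T) e" if "x \<in> verts T" for x
    using tree_two_sides[OF T, of u v x] that e v by auto
  then show ?thesis using that v side by blast
qed

text \<open>Two vertices are joined without \<open>e\<close> exactly when they lie on the same side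
  of it.\<close>

lemma separates_eq_splits:
  assumes T: "is_tree T" and e: "e \<in> edges T" and I: "I \<subseteq> verts T"
  shows "separates (edges T) e I \<longleftrightarrow> splits (edge_side (edges T) e) I"
proof -
  obtain u v where uv: "e = {u, v}" "u \<in> verts T" "v \<in> verts T"
    "\<And>x. x \<in> edge_side (edges T) e \<longleftrightarrow> joined (edges T - {e}) u x"
    "\<And>x. x \<in> verts T \<Longrightarrow> joined (edges T - {e}) v x \<longleftrightarrow> x \<notin> edge_side (edges T) e"
    by (rule edge_sideE[OF T e]) blast
  have "joined (edges T - {e}) x y \<longleftrightarrow> (x \<in> edge_side (edges T) e \<longleftrightarrow> y \<in> edge_side (edges T) e)"
    if "x \<in> verts T" "y \<in> verts T" for x y
    using uv(4)[of x] uv(4)[of y] uv(5)[of x] uv(5)[of y] that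
      joined_trans[of "edges T - {e}" u x y] joined_trans[of "edges T - {e}" u y x]
      joined_common[of "edges T - {e}" _ x y] joined_sym[of "edges T - {e}" x y] by blast
  then show ?thesis using I unfolding separates_def splits_def by blast
qed

text \<open>Of the two components left by deleting \<open>e\<close>, one misses \<open>f\<close>
  entirely. It stays connected when \<open>f\<close> is deleted and so lies on one side of
  \<open>f\<close>, which empties one of the four parts.\<close>

lemma edge_sides_compatible:
  assumes T: "is_tree T" and e: "e \<in> edges T" and f: "f \<in> edges T"
  shows "compatible (verts T) (edge_side (edges T) e) (edge_side (edges T) f)"
proof (cases "e = f")
  case True
  then show ?thesis by (simp add: compatible_def)
next
  case False
  let ?E = "edges T" and ?Se = "edge_side (edges T) e" and ?Sf = "edge_side (edges T) f"
  obtain u v where uv: "e = {u, v}" "u \<in> verts T" "v \<in> verts T"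
    "\<And>x. x \<in> ?Se \<longleftrightarrow> joined (?E - {e}) u x"
    "\<And>x. x \<in> verts T \<Longrightarrow> joined (?E - {e}) v x \<longleftrightarrow> x \<notin> ?Se"
    by (rule edge_sideE[OF T e]) blast
  obtain a b where ab: "f = {a, b}" "a \<in> verts T" "b \<in> verts T"
    "\<And>x. x \<in> ?Sf \<longleftrightarrow> joined (?E - {f}) a x"
    "\<And>x. x \<in> verts T \<Longrightarrow> joined (?E - {f}) b x \<longleftrightarrow> x \<notin> ?Sf"
    by (rule edge_sideE[OF T f]) blast
  have one_side: "(\<forall>x. joined (?E - {e}) p x \<longrightarrow> x \<in> ?Sf) \<or> (\<forall>x. joined (?E - {e}) p x \<longrightarrow> x \<notin> ?Sf)"
    if "\<not> joined (?E - {e}) p a" for p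
  proof -
    have p: "joined (?E - {f}) p x" if "joined (?E - {e}) p x" for x
      using component_avoiding_edge[OF f False _ ab(1) \<open>\<not> joined (?E - {e}) p a\<close> that] ab(1) by simp
    show ?thesis
    proof (cases "joined (?E - {f}) a p")
      case True
      then show ?thesis using p joined_trans[OF True] unfolding ab(4) by simp
    next
      case False
      then have "\<not> joined (?E - {f}) a x" if "joined (?E - {e}) p x" for x
        using joined_trans[OF _ joined_sym[OF p[OF that]]] by auto
      then show ?thesis unfolding ab(4) by simp
    qed
  qed
  show ?thesis
  proof (cases "joined (?E - {e}) u a")
    case True
    then have "\<not> joined (?E - {e}) v a" using uv(4,5) ab(2) by blast
    then show ?thesis using one_side[of v] uv(5) unfolding compatible_def by blast
  next
    case False
    then show ?thesis using one_side[of u] uv(4) unfolding compatible_def by blast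
  qed
qed

text \<open>Walk away from \<open>v\<close>: if \<open>u\<close> is not a leaf, it has another edge
  to some \<open>z\<close>, and the component of \<open>z\<close> beyond that edge is strictly
  smaller because it lacks \<open>u\<close>. The descent ends at a leaf.\<close>

lemma leaf_side_nonempty:
  assumes T: "is_tree T"
  shows "{u, v} \<in> edges T \<Longrightarrow> leaf_side T u v \<noteq> {}"
proof (induction "card {x \<in> verts T. joined (edges T - {{u, v}}) u x}" arbitrary: u v rule: less_induct)
  case less
  let ?E = "edges T"
  have u: "u \<in> verts T" "u \<noteq> v" using tree_edgeE[OF T less.prems] by (metis doubleton_eq_iff)+
  show ?case
  proof (cases "\<exists>f\<in>?E. u \<in> f \<and> f \<noteq> {u, v}")
    case False
    then have "{f \<in> ?E. u \<in> f} = {{u, v}}" using less.prems by blast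
    then have "u \<in> leaves T" using u(1) unfolding leaves_def by simp
    then show ?thesis by (auto simp: leaf_side_def)
  next
    case True
    then obtain f where f: "f \<in> ?E" "u \<in> f" "f \<noteq> {u, v}" by blast
    then obtain z where z: "f = {z, u}" by (metis insert_commute tree_edge_endpointE[OF T f(1,2)])
    have nz: "\<not> joined (?E - {f}) z u" using tree_edge_is_bridge[OF T, of z u] f(1) unfolding z by blast
    have uz: "joined (?E - {{u, v}}) u z"
      by (rule joined_edge) (use f(1,3) in \<open>simp add: z insert_commute\<close>)
    have sub: "joined (?E - {{u, v}}) u x" if "joined (?E - {f}) z x" for x
      by (rule joined_trans[OF uz component_avoiding_edge[OF less.prems f(3) _ refl nz that]]) simp
    have "card {x \<in> verts T. joined (?E - {{z, u}}) z x} < card {x \<in> verts T. joined (?E - {{u, v}}) u x}"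
    proof (rule psubset_card_mono)
      show "finite {x \<in> verts T. joined (?E - {{u, v}}) u x}" using tree_finite(1)[OF T] by simp
      show "{x \<in> verts T. joined (?E - {{z, u}}) z x} \<subset> {x \<in> verts T. joined (?E - {{u, v}}) u x}"
        using sub nz u(1) unfolding z by (auto simp: psubset_eq set_eq_iff)
    qed
    moreover have "{z, u} \<in> ?E" using f(1) unfolding z .
    ultimately obtain x where "x \<in> leaf_side T z u" using less.hyps[of z u] by blast
    then have "x \<in> leaf_side T u v"
      using sub z unfolding leaf_side_def joined_def by auto
    then show ?thesis by auto
  qed
qed

lemma leaf_sides:
  assumes T: "is_tree T" and e: "{u, v} \<in> edges T"
  shows "leaf_side T u v \<union> leaf_side T v u = leaves T" "leaf_side T u v \<inter> leaf_side T v u = {}"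
proof -
  have "x \<in> leaf_side T v u \<longleftrightarrow> x \<notin> leaf_side T u v" if "x \<in> leaves T" for x
    using tree_two_sides[OF T e, of x] that
    by (auto simp: leaf_side_def leaves_def joined_def insert_commute)
  then show "leaf_side T u v \<union> leaf_side T v u = leaves T" "leaf_side T u v \<inter> leaf_side T v u = {}"
    by (auto simp: leaf_side_def)
qed

lemma card_leaf_sides:
  assumes T: "is_tree T" and e: "{u, v} \<in> edges T"
  shows "card (leaf_side T u v) + card (leaf_side T v u) = card (leaves T)"
proof -
  have "finite (leaves T)" using tree_finite(1)[OF T] by (simp add: leaves_def)
  then show ?thesis
    using leaf_sides[OF T e] card_Un_disjoint[of "leaf_side T u v" "leaf_side T v u"]
    by (metis finite_Un)
qed

lemma separates_leaf_sides:
  assumes T: "is_tree T" and e: "{u, v} \<in> edges T" and I: "I \<subseteq> leaves T"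
  shows "separates (edges T) {u, v} I \<longleftrightarrow> I \<inter> leaf_side T u v \<noteq> {} \<and> I \<inter> leaf_side T v u \<noteq> {}"
proof -
  let ?J = "joined (edges T - {{u, v}})"
  have J: "?J x y \<longleftrightarrow> (x \<in> leaf_side T u v \<longleftrightarrow> y \<in> leaf_side T u v)"
    if "x \<in> leaves T" "y \<in> leaves T" for x y
  proof -
    have "x \<in> leaf_side T u v \<longleftrightarrow> ?J u x" "y \<in> leaf_side T u v \<longleftrightarrow> ?J u y"
      using that by (auto simp: leaf_side_def joined_def)
    moreover have "?J v x \<longleftrightarrow> \<not> ?J u x" "?J v y \<longleftrightarrow> \<not> ?J u y"
      using tree_two_sides[OF T e] that by (auto simp: leaves_def)
    ultimately show ?thesis
      using joined_trans[of "edges T - {{u, v}}" u x y] joined_trans[of "edges T - {{u, v}}" u y x]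
        joined_common[of "edges T - {{u, v}}" _ x y] joined_sym[of "edges T - {{u, v}}" x y] by blast
  qed
  then have "separates (edges T) {u, v} I \<longleftrightarrow>
      (\<exists>x\<in>I. \<exists>y\<in>I. (x \<in> leaf_side T u v) \<noteq> (y \<in> leaf_side T u v))"
    unfolding separates_def using I by (meson subsetD)
  also have "\<dots> \<longleftrightarrow> I \<inter> leaf_side T u v \<noteq> {} \<and> I - leaf_side T u v \<noteq> {}"
    by blast
  also have "I - leaf_side T u v = I \<inter> leaf_side T v u"
    using leaf_sides[OF T e] I by blast
  finally show ?thesis .
qed

section \<open>Weighted trees\<close>

lemma leaves_subset_verts: "leaves T \<subseteq> verts T"
  by (auto simp: leaves_def)

lemma D_sub_eq_split_sum:
  assumes T: "is_tree T" and I: "I \<subseteq> verts T" "I \<noteq> {}"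
  shows "D_sub (T, w) I = split_sum (edges T) (edge_side (edges T)) w I"
  unfolding D_sub_eq[OF assms] split_sum_def
  by (rule sum.cong) (use separates_eq_splits[OF T _ I(1)] in auto)

text \<open>Every edge has leaves on both sides and thus separates the full leaf set. The total
  weight is therefore a value of the split sum, to which the vanishing result applies.\<close>

lemma D_tot_eq_D_sub_leaves:
  assumes T: "is_tree T" and L: "leaves T \<noteq> {}"
  shows "D_tot (T, w) = D_sub (T, w) (leaves T)"
proof -
  have "separates (edges T) e (leaves T)" if e: "e \<in> edges T" for e
  proof -
    obtain u v where uv: "e = {u, v}" using tree_edgeE[OF T e] by blast
    have e': "{u, v} \<in> edges T" "{v, u} \<in> edges T" using e uv by (auto simp: insert_commute)
    have "leaf_side T u v \<subseteq> leaves T" "leaf_side T v u \<subseteq> leaves T"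
      by (auto simp: leaf_side_def)
    then show ?thesis
      unfolding uv separates_leaf_sides[OF T e'(1) order_refl]
      using leaf_side_nonempty[OF T e'(1)] leaf_side_nonempty[OF T e'(2)] by blast
  qed
  then show ?thesis
    unfolding D_sub_eq[OF T leaves_subset_verts L] D_tot_def by simp
qed

lemma pseudostar_large_side:
  assumes P: "pseudostar n k P" and e: "e \<in> edges P"
  shows "k \<le> card (leaves P \<inter> edge_side (edges P) e) \<or> k \<le> card (leaves P - edge_side (edges P) e)"
proof -
  have T: "is_tree P" using P by (simp add: pseudostar_def)
  obtain u v where uv: "e = {u, v}" "u \<in> verts P" "v \<in> verts P"
    "\<And>x. x \<in> edge_side (edges P) e \<longleftrightarrow> joined (edges P - {e}) u x"
    "\<And>x. x \<in> verts P \<Longrightarrow> joined (edges P - {e}) v x \<longleftrightarrow> x \<notin> edge_side (edges P) e"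
    by (rule edge_sideE[OF T e]) blast
  have "leaf_side P u v = leaves P \<inter> edge_side (edges P) e"
    using uv(4) unfolding leaf_side_def joined_def uv(1) by blast
  moreover have "leaf_side P v u = leaves P - edge_side (edges P) e"
    using uv(5) leaves_subset_verts[of P]
    unfolding leaf_side_def joined_def uv(1) insert_commute[of v u] by blast
  ultimately show ?thesis using P e uv(1) unfolding pseudostar_def by metis
qed

text \<open>The edges of both trees form one family of splits, with the second weight negated. Its
  sum vanishes on \<open>k\<close>-sets by hypothesis, hence on the full leaf set.\<close>

lemma pseudostar_D_tot_unique:
  assumes P: "pseudostar n k P" and P': "pseudostar n k P'"
    and L: "leaves P' = leaves P" and k: "2 \<le> k" "k < n"
    and eq: "\<And>I. I \<subseteq> leaves P \<Longrightarrow> card I = k \<Longrightarrow> D_sub (P, w) I = D_sub (P', w') I"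
  shows "D_tot (P, w) = D_tot (P', w')"
proof -
  have T: "is_tree P" "is_tree P'" and n: "card (leaves P) = n"
    using P P' by (auto simp: pseudostar_def)
  define X where "X = leaves P"
  define E where "E = edges P <+> edges P'"
  define S where "S = case_sum (edge_side (edges P)) (edge_side (edges P'))"
  define W where "W = case_sum w (\<lambda>e. - w' e)"
  have X: "finite X" "X \<noteq> {}" "X \<subseteq> verts P" "X \<subseteq> verts P'"
    using n k tree_finite(1)[OF T(1)] leaves_subset_verts[of P] leaves_subset_verts[of P'] L
    by (auto simp: X_def intro: finite_subset)
  have diff: "split_sum E S W I = D_sub (P, w) I - D_sub (P', w') I" if I: "I \<subseteq> X" "I \<noteq> {}" for I
  proof -
    have "split_sum E S W I = split_sum (edges P) (edge_side (edges P)) w I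
        - split_sum (edges P') (edge_side (edges P')) w' I"
      unfolding split_sum_def E_def S_def W_def
      by (simp add: sum.Plus tree_finite(2) T sum_negf[symmetric] if_distrib cong: if_cong)
    then show ?thesis
      using D_sub_eq_split_sum[OF T(1), of I] D_sub_eq_split_sum[OF T(2), of I] I X by auto
  qed
  have comp: "compatible X (edge_side (edges Q) e) (edge_side (edges Q) f)"
    if "is_tree Q" "X \<subseteq> verts Q" "e \<in> edges Q" "f \<in> edges Q" for Q e f
    using compatible_subset[OF edge_sides_compatible[OF that(1,3,4)] that(2)] .
  \<comment> \<open>\<open>isl\<close> tells the two trees apart. Among three indices two come from
    the same tree, and the splits of one tree are compatible.\<close>
  have compE: "compatible X (S a) (S b)" if "a \<in> E" "b \<in> E" "isl a = isl b" for a b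
    using that comp[OF T(1) X(3)] comp[OF T(2) X(4)]
    unfolding E_def S_def by (auto elim!: PlusE)
  have "split_sum E S W X = 0"
  proof (rule split_sum_vanishes[where k = k])
    show "finite E" using T by (simp add: E_def tree_finite(2))
    show "k < card X" using k n by (simp add: X_def)
    show "k \<le> card (X \<inter> S e) \<or> k \<le> card (X - S e)" if "e \<in> E" for e
    proof (cases e)
      case (Inl a)
      then show ?thesis using that pseudostar_large_side[OF P, of a] by (auto simp: E_def S_def X_def)
    next
      case (Inr a)
      then show ?thesis using that pseudostar_large_side[OF P', of a] L by (auto simp: E_def S_def X_def)
    qed
    show "compatible X (S a) (S b) \<or> compatible X (S a) (S c) \<or> compatible X (S b) (S c)"
      if "a \<in> E" "b \<in> E" "c \<in> E" for a b c
      using compE[of a b] compE[of a c] compE[of b c] that by metis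
    show "split_sum E S W I = 0" if "I \<subseteq> X" "card I = k" for I
    proof -
      have "I \<noteq> {}" using that k by auto
      then show ?thesis using diff[of I] eq[of I] that by (simp add: X_def)
    qed
  qed (use X k in auto)
  then have "D_sub (P, w) X = D_sub (P', w') X" using diff[of X] X by simp
  then show ?thesis
    using D_tot_eq_D_sub_leaves[OF T(1)] D_tot_eq_D_sub_leaves[OF T(2)] X L by (simp add: X_def)
qed

lemma pseudostar_if_half:
  assumes T: "is_tree T" and n: "card (leaves T) = n" and k: "2 * k \<le> n"
  shows "pseudostar n k T"
  unfolding pseudostar_def
proof (intro conjI allI impI)
  fix u v assume "{u, v} \<in> edges T"
  from card_leaf_sides[OF T this] show "k \<le> card (leaf_side T u v) \<or> k \<le> card (leaf_side T v u)"
    using n k by linarith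
qed (use T n in auto)

text \<open>An edge with fewer than \<open>k\<close> leaves on either side separates every \<open>k\<close>-set of leaves, so a
  weight \<open>t\<close> added to it is cancelled by subtracting \<open>t / k\<close> from each pendant edge.\<close>

lemma not_pseudostar_shift:
  assumes T: "is_tree T" and n: "card (leaves T) = n" and np: "\<not> pseudostar n k T" and k: "2 \<le> k"
  obtains w' where "D_tot (T, w') = D_tot (T, w) + t * (1 - real n / real k)"
    "\<And>I. I \<subseteq> leaves T \<Longrightarrow> card I = k \<Longrightarrow> D_sub (T, w') I = D_sub (T, w) I"
proof -
  obtain u v where uv: "{u, v} \<in> edges T" "card (leaf_side T u v) < k" "card (leaf_side T v u) < k"
    using np T n unfolding pseudostar_def by (auto simp: not_le)
  have finL: "finite (leaves T)" using finite_subset[OF leaves_subset_verts tree_finite(1)[OF T]] .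
  have "\<forall>i\<in>leaves T. \<exists>e. e \<in> edges T \<and>
      (\<forall>I. I \<subseteq> verts T \<longrightarrow> I \<noteq> {i} \<longrightarrow> (separates (edges T) e I \<longleftrightarrow> i \<in> I))"
    using leaf_pendant_edge[OF T] by metis
  then obtain p where p: "\<And>i. i \<in> leaves T \<Longrightarrow> p i \<in> edges T"
    "\<And>i I. i \<in> leaves T \<Longrightarrow> I \<subseteq> verts T \<Longrightarrow> I \<noteq> {i} \<Longrightarrow> separates (edges T) (p i) I \<longleftrightarrow> i \<in> I"
    by metis
  define w' where "w' e = w e + (if e = {u, v} then t else 0)
      - (\<Sum>i\<in>leaves T. if e = p i then t / real k else 0)" for e
  \<comment> \<open>\<open>Q\<close> is left arbitrary: constantly true it computes
    \<open>D_tot\<close>, and as separation of \<open>I\<close> it computes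
    \<open>D_sub\<close>.\<close>
  have sum_w': "(\<Sum>e\<in>edges T. if Q e then w' e else 0) = (\<Sum>e\<in>edges T. if Q e then w e else 0)
      + (if Q {u, v} then t else 0) - (\<Sum>i\<in>leaves T. if Q (p i) then t / real k else 0)" for Q
  proof -
    have "(\<Sum>e\<in>edges T. if Q e then w' e else 0)
        = (\<Sum>e\<in>edges T. (if Q e then w e else 0) + (if e = {u, v} then if Q e then t else 0 else 0)
            - (\<Sum>i\<in>leaves T. if e = p i then if Q e then t / real k else 0 else 0))"
      by (rule sum.cong) (auto simp: w'_def)
    also have "\<dots> = (\<Sum>e\<in>edges T. if Q e then w e else 0)
        + (\<Sum>e\<in>edges T. if e = {u, v} then if Q e then t else 0 else 0)
        - (\<Sum>e\<in>edges T. \<Sum>i\<in>leaves T. if e = p i then if Q e then t / real k else 0 else 0)"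
      by (simp add: sum.distrib sum_subtractf)
    also have "(\<Sum>e\<in>edges T. if e = {u, v} then if Q e then t else 0 else 0) = (if Q {u, v} then t else 0)"
      using uv(1) tree_finite(2)[OF T] by (simp add: sum.delta)
    also have "(\<Sum>e\<in>edges T. \<Sum>i\<in>leaves T. if e = p i then if Q e then t / real k else 0 else 0)
        = (\<Sum>i\<in>leaves T. \<Sum>e\<in>edges T. if e = p i then if Q e then t / real k else 0 else 0)"
      by (rule sum.swap)
    also have "\<dots> = (\<Sum>i\<in>leaves T. if Q (p i) then t / real k else 0)"
      by (rule sum.cong) (use p(1) tree_finite(2)[OF T] in \<open>auto simp: sum.delta\<close>)
    finally show ?thesis .
  qed
  \<comment> \<open>The weight \<open>t\<close> is added once, and \<open>t / k\<close> is
    subtracted once for each of the \<open>n\<close> leaves.\<close>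
  have "D_tot (T, w') = D_tot (T, w) + t * (1 - real n / real k)"
    using sum_w'[of "\<lambda>_. True"] n by (simp add: D_tot_def field_simps)
  moreover have "D_sub (T, w') I = D_sub (T, w) I" if I: "I \<subseteq> leaves T" "card I = k" for I
  proof -
    have Iv: "I \<subseteq> verts T" "I \<noteq> {}" using I k leaves_subset_verts[of T] by auto
    have fin: "finite (leaf_side T u v)" "finite (leaf_side T v u)"
      using finL by (auto simp: leaf_side_def)
    have "\<not> I \<subseteq> leaf_side T u v" "\<not> I \<subseteq> leaf_side T v u"
      using card_mono[OF fin(1), of I] card_mono[OF fin(2), of I] uv I by auto
    then have sep: "separates (edges T) {u, v} I"
      unfolding separates_leaf_sides[OF T uv(1) I(1)] using leaf_sides(1)[OF T uv(1)] I(1) by blast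
    have "(\<Sum>i\<in>leaves T. if separates (edges T) (p i) I then t / real k else 0)
        = (\<Sum>i\<in>leaves T. if i \<in> I then t / real k else 0)"
    proof (rule sum.cong)
      fix i assume i: "i \<in> leaves T"
      have "I \<noteq> {i}" using I k by auto
      then show "(if separates (edges T) (p i) I then t / real k else 0) = (if i \<in> I then t / real k else 0)"
        using p(2)[OF i Iv(1)] by simp
    qed simp
    also have "\<dots> = (\<Sum>i\<in>leaves T \<inter> I. t / real k)" by (rule sum.inter_restrict[OF finL, symmetric])
    also have "leaves T \<inter> I = I" using I by auto
    also have "(\<Sum>i\<in>I. t / real k) = t" using I k by simp
    finally show ?thesis using sum_w'[of "\<lambda>e. separates (edges T) e I"] sep
      by (simp add: D_sub_eq[OF T Iv])
  qed
  ultimately show ?thesis using that by blast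
qed

section \<open>Passage to a tree with prescribed leaves\<close>

lemma subtree_of_trans: "subtree_of H K \<Longrightarrow> subtree_of K T \<Longrightarrow> subtree_of H T"
  unfolding subtree_of_def subgraph_of_def by blast

text \<open>The subtree spanned by \<open>S\<close> contains \<open>I\<close>, hence also the
  minimal subtree for \<open>I\<close>, so pruning to \<open>S\<close> changes no value inside
  \<open>S\<close>.\<close>

lemma D_sub_spanned:
  assumes T: "is_tree T" and S: "S \<subseteq> verts T" and I: "I \<subseteq> S" "I \<noteq> {}"
  shows "D_sub (spanned T S, w) I = D_sub (T, w) I"
proof -
  have sub: "subtree_of (spanned T S) T" using spanned_subtree[OF T S] I by auto
  have IS: "I \<subseteq> verts (spanned T S)" using I by (auto simp: spanned_def)
  have "minimal_subtree (spanned T S) I = spanned T I"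
  proof (rule minimal_subtree_eqI)
    have "subgraph_of (spanned T I) (spanned T S)" by (rule spanned_least[OF T sub IS])
    then show "subtree_of (spanned T I) (spanned T S)"
      using spanned_subtree[OF T, of I] I S by (auto simp: subtree_of_def)
    show "I \<subseteq> verts (spanned T I)" by (simp add: spanned_def)
    show "subgraph_of (spanned T I) H" if "subtree_of H (spanned T S)" "I \<subseteq> verts H" for H
      by (rule spanned_least[OF T subtree_of_trans[OF that(1) sub] that(2)])
  qed
  moreover have "minimal_subtree T I = spanned T I"
    using I S by (intro minimal_subtree_eq_spanned[OF T]) auto
  ultimately show ?thesis by (simp add: D_sub_def)
qed

text \<open>An element of \<open>S\<close> keeps its only edge, because it must reach another
  element. A leaf outside \<open>S\<close> would hang on an edge not separating \<open>S\<close>,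
  but only separating edges are kept.\<close>

lemma leaves_spanned:
  assumes T: "is_tree T" and S: "S \<subseteq> leaves T" "2 \<le> card S"
  shows "leaves (spanned T S) = S"
proof -
  let ?H = "spanned T S"
  have Sv: "S \<subseteq> verts T" by (rule subset_trans[OF S(1) leaves_subset_verts])
  have S0: "S \<noteq> {}" using S by auto
  have sub: "subtree_of ?H T" by (rule spanned_subtree[OF T Sv S0])
  have H: "is_tree ?H" using sub by (simp add: subtree_of_def)
  show ?thesis
  proof
    show "S \<subseteq> leaves ?H"
    proof
      fix i assume i: "i \<in> S"
      have "card {e \<in> edges T. i \<in> e} = 1" using S i by (auto simp: leaves_def)
      then obtain e where e: "{e \<in> edges T. i \<in> e} = {e}" by (auto simp: card_1_singleton_iff)
      have "S \<noteq> {i}" using S by auto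
      then obtain j where j: "j \<in> S" "j \<noteq> i" using i by blast
      have "i \<in> verts ?H" "j \<in> verts ?H" using i j by (auto simp: spanned_def)
      then have "joined (edges ?H) i j" by (rule tree_joined[OF H])
      then obtain f where f: "f \<in> edges ?H" "i \<in> f" using joined_isolated[of "edges ?H" i j] j(2) by blast
      have sub_edges: "edges ?H \<subseteq> edges T" by (simp add: spanned_def)
      have "e' = e" if "e' \<in> edges ?H" "i \<in> e'" for e'
        using that sub_edges e by blast
      then have "{e \<in> edges ?H. i \<in> e} = {f}" using f by auto
      then show "i \<in> leaves ?H" using \<open>i \<in> verts ?H\<close> by (simp add: leaves_def)
    qed
    show "leaves ?H \<subseteq> S"
    proof
      fix i assume i: "i \<in> leaves ?H"
      show "i \<in> S"
      proof (rule ccontr)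
        assume "i \<notin> S"
        from leaf_pendant_edge[OF H i] obtain e where e: "e \<in> edges ?H"
          "\<And>I. I \<subseteq> verts ?H \<Longrightarrow> I \<noteq> {i} \<Longrightarrow> separates (edges ?H) e I \<longleftrightarrow> i \<in> I" by blast
        have "S \<noteq> {i}" "S \<subseteq> verts ?H" using S by (auto simp: spanned_def)
        then have "\<not> separates (edges ?H) e S" using e(2) \<open>i \<notin> S\<close> by simp
        moreover have "separates (edges T) e S" using e(1) by (simp add: spanned_def)
        then obtain x y where xy: "x \<in> S" "y \<in> S" "\<not> joined (edges T - {e}) x y"
          by (auto simp: separates_def)
        moreover have "edges ?H - {e} \<subseteq> edges T - {e}" by (auto simp: spanned_def)
        ultimately show False using joined_mono[of "edges ?H - {e}" x y "edges T - {e}"]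
          unfolding separates_def by blast
      qed
    qed
  qed
qed

text \<open>Renaming is called for because \<open>realizations\<close> asks for the leaf set
  \<open>{1..n}\<close> itself, whereas \<open>l_treelike\<close> supplies only a bijection with
  some of the leaves.\<close>

definition relabel :: "('v \<Rightarrow> 'u) \<Rightarrow> 'v ugraph \<Rightarrow> 'u ugraph" where
  "relabel g T = \<lparr>verts = g ` verts T, edges = (`) g ` edges T\<rparr>"

lemma joined_image:
  assumes g: "inj g"
  shows "joined ((`) g ` E) (g x) (g y) \<longleftrightarrow> joined E x y"
proof
  assume "joined E x y"
  then show "joined ((`) g ` E) (g x) (g y)"
    unfolding joined_def
  proof (induction rule: rtrancl_induct)
    case (step y z)
    have "g ` {y, z} \<in> (`) g ` E" using step.hyps(2) by (auto simp: adj_def simp del: image_insert)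
    then show ?case using step.IH by (auto simp: adj_def intro: rtrancl_into_rtrancl)
  qed simp
next
  have "\<exists>y. b = g y \<and> joined E x y" if "joined ((`) g ` E) (g x) b" for b
    using that unfolding joined_def
  proof (induction rule: rtrancl_induct)
    case (step b c)
    then obtain y where y: "b = g y" "(x, y) \<in> (adj E)\<^sup>*" by blast
    obtain e where e: "e \<in> E" "{g y, c} = g ` e" using step.hyps(2) y by (auto simp: adj_def)
    obtain z where z: "c = g z" using e by (metis imageE insertI1 insert_commute)
    have "g ` {y, z} = g ` e" using e z by simp
    then have "{y, z} = e" using g by (metis inj_image_eq_iff)
    then have "(y, z) \<in> adj E" using e by (simp add: adj_def)
    then show ?case using y z rtrancl_into_rtrancl by metis
  qed auto
  then show "joined ((`) g ` E) (g x) (g y) \<Longrightarrow> joined E x y"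
    using g by (metis injD)
qed

lemma is_tree_relabel:
  assumes T: "is_tree T" and g: "inj g"
  shows "is_tree (relabel g T)"
proof -
  have "card (g ` e) = card e" for e using g by (meson card_image inj_on_subset subset_UNIV)
  then have "simple_graph (relabel g T)"
    using T by (auto simp: is_tree_def simple_graph_def relabel_def nsets_def)
  moreover have "connected_graph (relabel g T)"
    using T joined_image[OF g, of "edges T"]
    by (auto simp: is_tree_def connected_graph_def relabel_def joined_def)
  moreover have "\<not> graph_cycle (relabel g T) c" for c
  proof
    assume c: "graph_cycle (relabel g T) c"
    then have edge: "\<And>i. i < length c \<Longrightarrow> {c ! i, c ! (Suc i mod length c)} \<in> (`) g ` edges T"
      by (simp add: graph_cycle_def relabel_def)
    \<comment> \<open>Every vertex of the cycle lies on an image edge, so the cycle is the image of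
      a list of original vertices.\<close>
    have "x \<in> range g" if "x \<in> set c" for x
    proof -
      obtain i where "i < length c" "x = c ! i" using \<open>x \<in> set c\<close> by (auto simp: in_set_conv_nth)
      then show ?thesis using edge[of i] by blast
    qed
    then obtain c' where c': "c = map g c'" by (metis ex_map_conv rangeE)
    have pos: "0 < length c'" using c c' by (auto simp: graph_cycle_def)
    have "{c' ! i, c' ! (Suc i mod length c')} \<in> edges T" if i: "i < length c'" for i
    proof -
      have "Suc i mod length c' < length c'" using pos by simp
      then have "g ` {c' ! i, c' ! (Suc i mod length c')} \<in> (`) g ` edges T"
        using edge[of i] i c' by simp
      then show ?thesis using g by (metis (no_types, lifting) imageE inj_image_eq_iff)
    qed
    then have "graph_cycle T c'"
      using c c' by (auto simp: graph_cycle_def distinct_map)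
    then show False using T by (auto simp: is_tree_def)
  qed
  ultimately show ?thesis by (simp add: is_tree_def)
qed

lemma leaves_relabel:
  assumes g: "inj g"
  shows "leaves (relabel g T) = g ` leaves T"
proof -
  have "card {e \<in> (`) g ` edges T. g x \<in> e} = card {e \<in> edges T. x \<in> e}" for x
  proof -
    have "{e \<in> (`) g ` edges T. g x \<in> e} = (`) g ` {e \<in> edges T. x \<in> e}"
      using inj_image_mem_iff[OF g, of x] by blast
    moreover have "inj_on ((`) g) {e \<in> edges T. x \<in> e}"
      using g by (auto simp: inj_on_def inj_image_eq_iff)
    ultimately show ?thesis by (simp add: card_image)
  qed
  then show ?thesis by (auto simp: leaves_def relabel_def)
qed

text \<open>Since \<open>g\<close> is injective, the preimage of an image edge is the original edge,
  so the new weight agrees with the old one.\<close>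

lemma D_sub_relabel:
  assumes T: "is_tree T" and g: "inj g" and I: "I \<subseteq> verts T" "I \<noteq> {}"
  shows "D_sub (relabel g T, \<lambda>e. w (g -` e)) (g ` I) = D_sub (T, w) I"
proof -
  have inj: "inj_on ((`) g) (edges T)" using g by (auto simp: inj_on_def inj_image_eq_iff)
  have sep: "separates ((`) g ` edges T) (g ` e) (g ` I) \<longleftrightarrow> separates (edges T) e I" for e
  proof -
    have "(`) g ` edges T - {g ` e} = (`) g ` (edges T - {e})"
      using g by (auto simp: inj_image_eq_iff)
    then show ?thesis unfolding separates_def by (simp add: joined_image[OF g])
  qed
  have gI: "g ` I \<subseteq> verts (relabel g T)" "g ` I \<noteq> {}" using I by (auto simp: relabel_def)
  show ?thesis
    unfolding D_sub_eq[OF is_tree_relabel[OF T g] gI] D_sub_eq[OF T I]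
    by (simp add: relabel_def sum.reindex[OF inj] sep inj_vimage_image_eq[OF g] cong: if_cong)
qed

text \<open>The given tree is pruned to the subtree spanned by \<open>S\<close>, and its leaves are
  renamed by the inverse of \<open>f\<close>.\<close>

lemma realizations_nonempty:
  assumes D: "l_treelike n k D" and k: "2 \<le> k" "k \<le> n"
  shows "realizations n k D \<noteq> {}"
proof -
  obtain T :: "nat ugraph" and w S f where T: "is_tree T" and S: "S \<subseteq> leaves T"
    and f: "bij_betw f {1..n} S" and DI: "\<And>I. I \<in> [{1..n}]\<^bsup>k\<^esup> \<Longrightarrow> D_sub (T, w) (f ` I) = D I"
    using D unfolding l_treelike_def by blast
  let ?H = "spanned T S"
  have cS: "card S = n" using bij_betw_same_card[OF f] by simp
  have Sv: "S \<subseteq> verts T" by (rule subset_trans[OF S leaves_subset_verts])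
  have S0: "S \<noteq> {}" using cS k by auto
  have H: "is_tree ?H" using spanned_subtree[OF T Sv S0] by (simp add: subtree_of_def)
  have LH: "leaves ?H = S" by (rule leaves_spanned[OF T S]) (use cS k in simp)
  \<comment> \<open>The shift by \<open>Suc n\<close> sends the vertices outside \<open>S\<close>
    above \<open>n\<close>, away from the labels of the leaves, so \<open>g\<close> is
    injective.\<close>
  define g where "g x = (if x \<in> S then inv_into {1..n} f x else x + Suc n)" for x
  have fS: "f ` {1..n} = S" and finj: "inj_on f {1..n}" using f by (auto simp: bij_betw_def)
  have low: "inv_into {1..n} f x \<in> {1..n}" if "x \<in> S" for x
    using that fS inv_into_into[of x f "{1..n}"] by simp
  have "inj g"
  proof (rule injI)
    fix x y assume "g x = g y"
    then show "x = y"
      using low[of x] low[of y] inj_on_inv_into[of S f "{1..n}"] fS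
      unfolding g_def by (auto split: if_splits dest: inj_onD)
  qed
  have gf: "g (f i) = i" if "i \<in> {1..n}" for i
    using that fS finj by (auto simp: g_def)
  have "g ` f ` {1..n} = {1..n}" unfolding image_image using gf by simp
  then have "leaves (relabel g ?H) = {1..n}"
    unfolding leaves_relabel[OF \<open>inj g\<close>] LH fS .
  moreover have "D_sub (relabel g ?H, \<lambda>e. w (g -` e)) I = D I" if I: "I \<in> [{1..n}]\<^bsup>k\<^esup>" for I
  proof -
    have I': "I \<subseteq> {1..n}" "I \<noteq> {}" using I k by (auto simp: nsets_def)
    have fI: "f ` I \<subseteq> S" "f ` I \<noteq> {}" using I' fS by auto
    have "g ` f ` I = I" using gf I' by (force simp: image_image)
    then have "D_sub (relabel g ?H, \<lambda>e. w (g -` e)) I = D_sub (?H, w) (f ` I)"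
      using D_sub_relabel[OF H \<open>inj g\<close>, of "f ` I" w] fI by (auto simp: spanned_def)
    also have "\<dots> = D_sub (T, w) (f ` I)" by (rule D_sub_spanned[OF T Sv fI])
    finally show ?thesis using DI[OF I] by simp
  qed
  ultimately show ?thesis
    using is_tree_relabel[OF H \<open>inj g\<close>] unfolding realizations_def by blast
qed

section \<open>Infimum and supremum of the total weight\<close>

lemma unbounded_INF_SUP:
  fixes F :: "'a \<Rightarrow> real"
  assumes "\<And>r. \<exists>x\<in>U. F x = r"
  shows "(INF x\<in>U. ereal (F x)) = -\<infinity>" "(SUP x\<in>U. ereal (F x)) = \<infinity>"
proof -
  show "(SUP x\<in>U. ereal (F x)) = \<infinity>"
  proof (rule SUP_PInfty)
    fix m :: nat
    show "\<exists>x\<in>U. ereal (real m) \<le> ereal (F x)" using assms[of "real m"] by force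
  qed
  show "(INF x\<in>U. ereal (F x)) = -\<infinity>"
  proof (rule ereal_bot)
    fix B :: real
    obtain x where "x \<in> U" "F x = B" using assms by blast
    then show "(INF x\<in>U. ereal (F x)) \<le> ereal B" by (metis INF_lower)
  qed
qed

theorem theorem4p2:
  fixes k n :: nat and D :: "nat set \<Rightarrow> real" and U :: "nat weighted_tree set"
  assumes "3 \<le> k" and "k \<le> n - 1"
    and "l_treelike n k D"
    and "U = realizations n k D"
  shows "(real k \<le> real n / 2 \<longrightarrow> (\<forall>(P, w)\<in>U. pseudostar n k P)) \<and>
    ((\<forall>(P, w)\<in>U. pseudostar n k P) \<longrightarrow>
      (\<forall>\<P>\<in>U. \<forall>\<P>'\<in>U. D_tot \<P> = D_tot \<P>') \<and>
      (INF \<P>\<in>U. ereal (D_tot \<P>)) = (SUP \<P>\<in>U. ereal (D_tot \<P>))) \<and>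
    ((\<exists>(P, w)\<in>U. \<not> pseudostar n k P) \<longrightarrow>
      (INF \<T>\<in>U. ereal (D_tot \<T>)) = -\<infinity> \<and>
      (SUP \<T>\<in>U. ereal (D_tot \<T>)) = \<infinity>)"
proof (intro conjI impI)
  have k: "2 \<le> k" "k < n" using assms by auto
  have U: "(T, w) \<in> U \<longleftrightarrow> is_tree T \<and> leaves T = {1..n} \<and> (\<forall>I\<in>[{1..n}]\<^bsup>k\<^esup>. D_sub (T, w) I = D I)" for T w
    using assms(4) by (simp add: realizations_def)
  show "\<forall>(P, w)\<in>U. pseudostar n k P" if "real k \<le> real n / 2"
    using that U by (auto intro!: pseudostar_if_half)
  show const: "\<forall>\<P>\<in>U. \<forall>\<P>'\<in>U. D_tot \<P> = D_tot \<P>'" if P: "\<forall>(P, w)\<in>U. pseudostar n k P"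
  proof (intro ballI)
    fix \<P> \<P>' assume in_U: "\<P> \<in> U" "\<P>' \<in> U"
    obtain T w T' w' where eq: "\<P> = (T, w)" "\<P>' = (T', w')" by fastforce
    have TU: "(T, w) \<in> U" "(T', w') \<in> U" using in_U eq by auto
    have "D_sub (T, w) I = D_sub (T', w') I" if "I \<subseteq> leaves T" "card I = k" for I
    proof -
      have "I \<in> [{1..n}]\<^bsup>k\<^esup>" using that TU(1) U finite_subset[of I "{1..n}"] by (auto simp: nsets_def)
      then show ?thesis using TU U by simp
    qed
    then have "D_tot (T, w) = D_tot (T', w')"
      using P TU U k by (intro pseudostar_D_tot_unique[of n k T T']) auto
    then show "D_tot \<P> = D_tot \<P>'" by (simp add: eq)
  qed
  show "(INF \<P>\<in>U. ereal (D_tot \<P>)) = (SUP \<P>\<in>U. ereal (D_tot \<P>))" if P: "\<forall>(P, w)\<in>U. pseudostar n k P"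
  proof -
    \<comment> \<open>An empty family would have infimum \<open>\<infinity>\<close> and supremum
      \<open>-\<infinity>\<close>, so the existence of a realization matters here.\<close>
    have "U \<noteq> {}" using realizations_nonempty[OF assms(3)] k assms(4) by simp
    then obtain \<Q> where Q: "\<Q> \<in> U" by blast
    have "(\<lambda>\<P>. ereal (D_tot \<P>)) ` U = (\<lambda>_. ereal (D_tot \<Q>)) ` U"
    proof (rule image_cong)
      fix \<P> assume "\<P> \<in> U"
      then have "D_tot \<P> = D_tot \<Q>" using const[OF P] Q by blast
      then show "ereal (D_tot \<P>) = ereal (D_tot \<Q>)" by simp
    qed simp
    then show ?thesis using \<open>U \<noteq> {}\<close> by simp
  qed
  have all: "\<exists>\<T>\<in>U. D_tot \<T> = r" if np: "\<exists>(P, w)\<in>U. \<not> pseudostar n k P" for r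
  proof -
    obtain T w where T: "(T, w) \<in> U" "\<not> pseudostar n k T" using np by blast
    \<comment> \<open>Solves \<open>D_tot (T, w) + t * (1 - n / k) = r\<close>. The coefficient is
      nonzero because \<open>k < n\<close>, so every real value is attained.\<close>
    define t where "t = (r - D_tot (T, w)) / (1 - real n / real k)"
    have T': "is_tree T" "card (leaves T) = n" using T(1) U by auto
    obtain w' where w': "D_tot (T, w') = D_tot (T, w) + t * (1 - real n / real k)"
      "\<And>I. I \<subseteq> leaves T \<Longrightarrow> card I = k \<Longrightarrow> D_sub (T, w') I = D_sub (T, w) I"
      using not_pseudostar_shift[OF T' T(2) k(1)] by metis
    have "1 - real n / real k \<noteq> 0" using k by (simp add: field_simps)
    then have "D_tot (T, w') = r" unfolding w'(1) t_def by simp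
    moreover have "(T, w') \<in> U" using T(1) w'(2) U by (auto simp: nsets_def)
    ultimately show ?thesis by blast
  qed
  show "(INF \<T>\<in>U. ereal (D_tot \<T>)) = -\<infinity>" if "\<exists>(P, w)\<in>U. \<not> pseudostar n k P"
    by (rule unbounded_INF_SUP) (rule all[OF that])
  show "(SUP \<T>\<in>U. ereal (D_tot \<T>)) = \<infinity>" if "\<exists>(P, w)\<in>U. \<not> pseudostar n k P"
    by (rule unbounded_INF_SUP) (rule all[OF that])
qed

end
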